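(* Let $r,s,n$ be positive integers. If a sums-of-squares formula of type $[r,s,n]$ exists over some field $F$ of characteristic not $2$, then a sums-of-squares formula of type $[r,s,n]$ exists over some finite field of characteristic not $2$.
   Context: Let $F$ be a field of characteristic not $2$. A sums-of-squares formula of type $[r,s,n]$ over $F$ is a polynomial identity $(x_1^2+\cdots+x_r^2)(y_1^2+\cdots+y_s^2)=z_1^2+\cdots+z_n^2$ in the polynomial ring $F[x_1,\dots,x_r,y_1,\dots,y_s]$, where each $z_i$ is a bilinear expression in the $x$'s and $y$'s over $F$, i.e. $z_i=\sum_{j,k}\alpha_{ijk}x_jy_k$ with $\alpha_{ijk}\in F$. *)

theory Defs
  imports "HOL-Algebra.Algebra"
begin

text \<open>The additive order of \<open>1\<close>; \<^const>\<open>group.ord\<close> is \<open>0\<close> on elements of infinite order.\<close>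
definition ring_char :: "('a, 'b) ring_scheme \<Rightarrow> nat"
  where "ring_char R = group.ord (add_monoid R) \<one>\<^bsub>R\<^esub>"

text \<open>\<open>HOL-Algebra.Indexed_Polynomials\<close> represents a polynomial in variables indexed by \<open>I\<close> as the
  function taking a monomial (a multiset over \<open>I\<close>) to its coefficient, but it has no product of
  two polynomials and no ring record. The product is the Cauchy product.\<close>
definition indexed_poly_ring :: "('a, 'b) ring_scheme \<Rightarrow> 'c set \<Rightarrow> ('c multiset \<Rightarrow> 'a) ring"
  where "indexed_poly_ring R I =
    \<lparr> carrier = ring.indexed_pset R I (carrier R),
      monoid.mult = (\<lambda>P Q m. \<Oplus>\<^bsub>R\<^esub>u\<in>{u. u \<subseteq># m}. P u \<otimes>\<^bsub>R\<^esub> Q (m - u)),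
      monoid.one = ring.indexed_const R \<one>\<^bsub>R\<^esub>,
      ring.zero = ring.indexed_const R \<zero>\<^bsub>R\<^esub>,
      ring.add = ring.indexed_padd R \<rparr>"

lemma (in ring) ring_char_dvd: "add_pow R (n :: nat) \<one> = \<zero> \<longleftrightarrow> ring_char R dvd n"
  using add.pow_eq_id[of \<one> n] by (simp add: ring_char_def)

text \<open>\<^const>\<open>finsum\<close> and powers are meaningful only in an actual ring; the following lemmas show that
  \<^const>\<open>indexed_poly_ring\<close> is one.\<close>

context cring
begin

lemma finite_submultisets: "finite {u. u \<subseteq># (m :: 'c multiset)}"
proof (rule finite_subset)
  show "{u. u \<subseteq># m} \<subseteq> mset ` {xs. set xs \<subseteq> set_mset m \<and> length xs \<le> size m}"
  proof
    fix u assume u: "u \<in> {u. u \<subseteq># m}"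
    obtain xs where xs: "mset xs = u" using ex_mset by blast
    have "set xs \<subseteq> set_mset m" "length xs \<le> size m"
      using u set_mset_mono[of u m] size_mset_mono[of u m] by (auto simp flip: xs)
    then show "u \<in> mset ` {xs. set xs \<subseteq> set_mset m \<and> length xs \<le> size m}"
      using xs by blast
  qed
  show "finite (mset ` {xs. set xs \<subseteq> set_mset m \<and> length xs \<le> size m})"
    by (simp add: finite_lists_length_le)
qed

definition indexed_conv :: "('c multiset \<Rightarrow> 'a) \<Rightarrow> ('c multiset \<Rightarrow> 'a) \<Rightarrow> 'c multiset \<Rightarrow> 'a"
  where "indexed_conv P Q m = (\<Oplus>u\<in>{u. u \<subseteq># m}. P u \<otimes> Q (m - u))"

lemma indexed_conv_closed:
  assumes "carrier_coeff P" "carrier_coeff Q" shows "carrier_coeff (indexed_conv P Q)"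
  using assms unfolding carrier_coeff_def indexed_conv_def by (auto intro!: finsum_closed)

lemma indexed_conv_comm:
  fixes P :: "'c multiset \<Rightarrow> 'a"
  assumes "carrier_coeff P" "carrier_coeff Q" shows "indexed_conv P Q = indexed_conv Q P"
proof
  fix m :: "'c multiset"
  have inv: "m - (m - u) = u" if "u \<subseteq># m" for u :: "'c multiset"
    using that by (metis add_diff_cancel_right' subset_mset.add_diff_inverse)
  have im: "(\<lambda>u. m - u) ` {u. u \<subseteq># m} = {u. u \<subseteq># m}"
  proof (intro equalityI subsetI)
    fix u assume "u \<in> {u. u \<subseteq># m}"
    then have "u = m - (m - u)" "m - u \<in> {u. u \<subseteq># m}" using inv by auto
    then show "u \<in> (\<lambda>u. m - u) ` {u. u \<subseteq># m}" by blast
  qed auto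
  have inj: "inj_on (\<lambda>u. m - u) {u. u \<subseteq># m}"
    by (rule inj_on_inverseI[where g = "\<lambda>u. m - u"]) (simp add: inv)
  have "indexed_conv P Q m = (\<Oplus>u\<in>(\<lambda>u. m - u) ` {u. u \<subseteq># m}. P u \<otimes> Q (m - u))"
    unfolding im indexed_conv_def ..
  also have "\<dots> = (\<Oplus>u\<in>{u. u \<subseteq># m}. P (m - u) \<otimes> Q (m - (m - u)))"
    using assms inj unfolding carrier_coeff_def by (subst finsum_reindex) auto
  also have "\<dots> = indexed_conv Q P m"
    using assms unfolding indexed_conv_def carrier_coeff_def
    by (auto intro!: finsum_cong' simp: m_comm inv)
  finally show "indexed_conv P Q m = indexed_conv Q P m" .
qed

lemma indexed_conv_const:
  assumes "k \<in> carrier R" "carrier_coeff Q"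
  shows "indexed_conv (indexed_const k) Q = (\<lambda>m. k \<otimes> Q m)"
proof
  fix m
  have "indexed_conv (indexed_const k) Q m = (\<Oplus>u\<in>{u. u \<subseteq># m}. if {#} = u then k \<otimes> Q (m - u) else \<zero>)"
    using assms unfolding indexed_conv_def indexed_const_def carrier_coeff_def
    by (auto intro!: finsum_cong')
  also have "\<dots> = k \<otimes> Q (m - {#})"
    using assms finite_submultisets unfolding carrier_coeff_def
    by (subst finsum_singleton) auto
  finally show "indexed_conv (indexed_const k) Q m = k \<otimes> Q m" by simp
qed

lemma indexed_conv_padd:
  assumes "carrier_coeff P" "carrier_coeff P'" "carrier_coeff Q"
  shows "indexed_conv (P \<Oplus> P') Q = indexed_conv P Q \<Oplus> indexed_conv P' Q"
  using assms unfolding indexed_conv_def indexed_padd_def carrier_coeff_def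
  by (auto simp: l_distr finsum_addf intro!: ext)

lemma indexed_conv_pmult:
  assumes "carrier_coeff P" "carrier_coeff Q"
  shows "indexed_conv (P \<Otimes> i) Q = indexed_conv P Q \<Otimes> i"
proof
  fix m
  let ?f = "\<lambda>u. (P \<Otimes> i) u \<otimes> Q (m - u)"
  have f: "?f u \<in> carrier R" for u
    using assms unfolding carrier_coeff_def indexed_pmult_def by auto
  show "indexed_conv (P \<Otimes> i) Q m = (indexed_conv P Q \<Otimes> i) m"
  proof (cases "i \<in># m")
    case False
    then have "?f u = \<zero>" if "u \<subseteq># m" for u
      using that assms mset_subset_eqD[of u m i] unfolding indexed_pmult_def carrier_coeff_def by auto
    then have "indexed_conv (P \<Otimes> i) Q m = (\<Oplus>u\<in>{u. u \<subseteq># m}. \<zero>)"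
      unfolding indexed_conv_def by (intro finsum_cong') auto
    then show ?thesis using False by (simp add: indexed_pmult_def)
  next
    case True
    have im: "add_mset i ` {u. u \<subseteq># m - {#i#}} = {u. u \<subseteq># m \<and> i \<in># u}"
    proof (intro equalityI subsetI)
      fix u assume "u \<in> add_mset i ` {u. u \<subseteq># m - {#i#}}"
      then show "u \<in> {u. u \<subseteq># m \<and> i \<in># u}"
        using True by (auto simp: insert_subset_eq_iff)
    next
      fix u assume "u \<in> {u. u \<subseteq># m \<and> i \<in># u}"
      then have "u = add_mset i (u - {#i#})" "u - {#i#} \<subseteq># m - {#i#}"
        using True by (auto simp: insert_subset_eq_iff intro: subset_eq_diff_conv[THEN iffD2])
      then show "u \<in> add_mset i ` {u. u \<subseteq># m - {#i#}}" by blast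
    qed
    have "indexed_conv (P \<Otimes> i) Q m = (\<Oplus>u\<in>{u. u \<subseteq># m \<and> i \<in># u}. ?f u)"
      unfolding indexed_conv_def
      by (rule add.finprod_mono_neutral_cong_right[OF finite_submultisets])
         (use assms f in \<open>auto simp: indexed_pmult_def carrier_coeff_def\<close>)
    also have "\<dots> = (\<Oplus>u\<in>{u. u \<subseteq># m - {#i#}}. ?f (add_mset i u))"
      unfolding im[symmetric] using f by (subst finsum_reindex) (auto simp: inj_on_def)
    also have "\<dots> = indexed_conv P Q (m - {#i#})"
      unfolding indexed_conv_def using assms
      by (intro finsum_cong') (auto simp: indexed_pmult_def carrier_coeff_def)
    finally show ?thesis using True by (simp add: indexed_pmult_def)
  qed
qed

lemma indexed_pset_coeff: "P \<in> (carrier R[\<X>\<^bsub>I\<^esub>]) \<Longrightarrow> carrier_coeff P"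
  using indexed_pset_in_carrier by blast

lemma indexed_pset_scale:
  assumes "k \<in> carrier R" "Q \<in> (carrier R[\<X>\<^bsub>I\<^esub>])"
  shows "(\<lambda>m :: 'c multiset. k \<otimes> Q m) \<in> (carrier R[\<X>\<^bsub>I\<^esub>])"
  using assms(2)
proof (induction)
  case (indexed_const c)
  have "(\<lambda>m :: 'c multiset. k \<otimes> indexed_const c m) = indexed_const (k \<otimes> c)"
    using assms(1) indexed_const by (auto simp: indexed_const_def)
  moreover have "(indexed_const (k \<otimes> c) :: 'c multiset \<Rightarrow> 'a) \<in> (carrier R[\<X>\<^bsub>I\<^esub>])"
    using assms(1) indexed_const by (simp add: indexed_pset.indexed_const)
  ultimately show ?case by (simp only:)
next
  case (indexed_padd P Q)
  have "(\<lambda>m. k \<otimes> (P \<Oplus> Q) m) = (\<lambda>m. k \<otimes> P m) \<Oplus> (\<lambda>m. k \<otimes> Q m)"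
    using assms(1) indexed_padd(1,2)[THEN indexed_pset_coeff]
    by (auto simp: indexed_padd_def carrier_coeff_def r_distr)
  then show ?case using indexed_padd.IH indexed_pset.indexed_padd by (simp only:)
next
  case (indexed_pmult P i)
  have "(\<lambda>m. k \<otimes> (P \<Otimes> i) m) = (\<lambda>m. k \<otimes> P m) \<Otimes> i"
    using assms(1) by (auto simp: indexed_pmult_def)
  then show ?case using indexed_pmult indexed_pset.indexed_pmult by (simp only:)
qed

lemma indexed_conv_in_pset:
  assumes "P \<in> (carrier R[\<X>\<^bsub>I\<^esub>])" "Q \<in> (carrier R[\<X>\<^bsub>I\<^esub>])"
  shows "indexed_conv P Q \<in> (carrier R[\<X>\<^bsub>I\<^esub>])"
  using assms(1)
proof (induction)
  case (indexed_const k)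
  then show ?case using assms(2) by (simp add: indexed_conv_const indexed_pset_coeff indexed_pset_scale)
next
  case (indexed_padd P P')
  then show ?case
    using assms(2) by (simp add: indexed_conv_padd indexed_pset_coeff indexed_pset.indexed_padd)
next
  case (indexed_pmult P i)
  then show ?case
    using assms(2) by (simp add: indexed_conv_pmult indexed_pset_coeff indexed_pset.indexed_pmult)
qed

lemma indexed_conv_assoc:
  assumes "P \<in> (carrier R[\<X>\<^bsub>I\<^esub>])" "carrier_coeff Q" "carrier_coeff S"
  shows "indexed_conv (indexed_conv P Q) S = indexed_conv P (indexed_conv Q S)"
  using assms(1)
proof (induction)
  case (indexed_const k)
  have "indexed_conv (\<lambda>m. k \<otimes> Q m) S = (\<lambda>m. k \<otimes> indexed_conv Q S m)"
    using assms(2,3) indexed_const unfolding indexed_conv_def carrier_coeff_def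
    by (auto simp: finsum_rdistr m_assoc finite_submultisets Pi_def intro!: ext)
  then show ?case using assms(2,3) indexed_const by (simp add: indexed_conv_const indexed_conv_closed)
next
  case (indexed_padd P P')
  then show ?case using assms(2,3) by (simp add: indexed_conv_padd indexed_conv_closed indexed_pset_coeff)
next
  case (indexed_pmult P i)
  then show ?case using assms(2,3) by (simp add: indexed_conv_pmult indexed_conv_closed indexed_pset_coeff)
qed

lemma indexed_poly_ring_cring: "cring (indexed_poly_ring R I)"
proof -
  let ?P = "indexed_poly_ring R I"
  have sel: "carrier ?P = (carrier R[\<X>\<^bsub>I\<^esub>])" "monoid.mult ?P = indexed_conv" "monoid.one ?P = indexed_const \<one>"
    "ring.zero ?P = indexed_const \<zero>" "ring.add ?P = indexed_padd"
    by (simp_all add: indexed_poly_ring_def indexed_conv_def fun_eq_iff)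
  note co = indexed_pset_coeff
  have one: "indexed_conv (indexed_const \<one>) Q = Q" if "carrier_coeff Q" for Q :: "'c multiset \<Rightarrow> 'a"
    using that by (simp add: indexed_conv_const carrier_coeff_def)
  show ?thesis
  proof (rule cringI)
    show "abelian_group ?P"
    proof (rule abelian_groupI)
      fix x assume x: "x \<in> carrier ?P"
      have "(\<lambda>m. (\<ominus> \<one>) \<otimes> x m) \<Oplus> x = indexed_const \<zero>"
        using co[of x] x by (auto simp: sel indexed_padd_def indexed_zero_def carrier_coeff_def l_minus l_neg)
      then show "\<exists>y\<in>carrier ?P. y \<oplus>\<^bsub>?P\<^esub> x = \<zero>\<^bsub>?P\<^esub>"
        using x indexed_pset_scale[of "\<ominus> \<one>" x I] by (auto simp: sel)
    next
      fix x y z assume "x \<in> carrier ?P" "y \<in> carrier ?P" "z \<in> carrier ?P"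
      then have "x m \<in> carrier R" "y m \<in> carrier R" "z m \<in> carrier R" for m
        using co unfolding sel carrier_coeff_def by blast+
      then show "x \<oplus>\<^bsub>?P\<^esub> y \<oplus>\<^bsub>?P\<^esub> z = x \<oplus>\<^bsub>?P\<^esub> (y \<oplus>\<^bsub>?P\<^esub> z)"
        unfolding sel indexed_padd_def by (simp add: a_assoc)
    next
      fix x y assume "x \<in> carrier ?P" "y \<in> carrier ?P"
      then have "x m \<in> carrier R" "y m \<in> carrier R" for m
        using co unfolding sel carrier_coeff_def by blast+
      then show "x \<oplus>\<^bsub>?P\<^esub> y = y \<oplus>\<^bsub>?P\<^esub> x"
        unfolding sel indexed_padd_def by (simp add: a_comm)
    qed (simp_all add: sel indexed_padd_zero co indexed_pset.intros)
    show "comm_monoid ?P"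
      by (rule comm_monoidI)
         (auto simp: sel indexed_conv_in_pset indexed_conv_assoc co indexed_pset.intros one intro: indexed_conv_comm)
  qed (simp add: sel indexed_conv_padd co)
qed

end

text \<open>The variables \<open>x\<^sub>1, \<dots>, x\<^sub>r\<close> are indexed by \<open>Inl 1, \<dots>, Inl r\<close> and \<open>y\<^sub>1, \<dots>, y\<^sub>s\<close> by
  \<open>Inr 1, \<dots>, Inr s\<close>; \<open>\<alpha> i j k\<close> is the coefficient of \<open>x\<^sub>j y\<^sub>k\<close> in \<open>z\<^sub>i\<close>.\<close>
definition sums_of_squares_formula ::
    "('a, 'b) ring_scheme \<Rightarrow> nat \<Rightarrow> nat \<Rightarrow> nat \<Rightarrow> (nat \<Rightarrow> nat \<Rightarrow> nat \<Rightarrow> 'a) \<Rightarrow> bool"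
  where "sums_of_squares_formula F r s n \<alpha> \<longleftrightarrow>
    (\<forall>i\<in>{1..n}. \<forall>j\<in>{1..r}. \<forall>k\<in>{1..s}. \<alpha> i j k \<in> carrier F) \<and>
    (let P = indexed_poly_ring F (Inl ` {1..r} \<union> Inr ` {1..s});
         x = (\<lambda>j. ring.indexed_var F (Inl j));
         y = (\<lambda>k. ring.indexed_var F (Inr k));
         z = (\<lambda>i. \<Oplus>\<^bsub>P\<^esub>j\<in>{1..r}. \<Oplus>\<^bsub>P\<^esub>k\<in>{1..s}.
                ring.indexed_const F (\<alpha> i j k) \<otimes>\<^bsub>P\<^esub> (x j \<otimes>\<^bsub>P\<^esub> y k))
     in (\<Oplus>\<^bsub>P\<^esub>j\<in>{1..r}. x j [^]\<^bsub>P\<^esub> (2::nat)) \<otimes>\<^bsub>P\<^esub> (\<Oplus>\<^bsub>P\<^esub>k\<in>{1..s}. y k [^]\<^bsub>P\<^esub> (2::nat)) =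
        (\<Oplus>\<^bsub>P\<^esub>i\<in>{1..n}. z i [^]\<^bsub>P\<^esub> (2::nat)))"

end

theory Submission
  imports Defs "HOL-Number_Theory.Residues"
begin

text \<open>
  A sums-of-squares formula over \<open>F\<close> is an identity between polynomials whose coefficients lie in the
  subring \<open>A \<subseteq> F\<close> generated by the finitely many \<open>\<alpha> i j k\<close>. A ring homomorphism \<open>\<phi>\<close> from \<open>A\<close> to a field \<open>L\<close>
  carries the identity to \<open>L\<close> (\<open>sums_of_squares_formula_hom\<close>), and \<open>L\<close> has characteristic different
  from \<open>2\<close> as soon as \<open>\<phi> 2 \<noteq> 0\<close>. So it is enough to know that a finitely generated domain has enough
  homomorphisms to finite fields: for every \<open>a \<noteq> 0\<close> there is one with \<open>\<phi> a \<noteq> 0\<close>.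

  This is proved by adjoining one generator at a time. As long as the targets \<open>L\<close> are algebraically
  closed, a homomorphism on \<open>A\<close> extends to \<open>A[b]\<close>, without killing a given \<open>y \<in> A[b] - {0}\<close>, provided it
  does not kill a certain nonzero element of \<open>A\<close> that depends on \<open>b\<close> and \<open>y\<close>
  (\<open>separated_by_simple_extension\<close>). For transcendental \<open>b\<close> almost every value of \<open>b\<close> will do; for
  algebraic \<open>b\<close> the value is a root of the image of a relation of \<open>b\<close> of least degree, and
  pseudo-division by it shows that all other relations are respected
  (\<open>relations_transfer_from_minimal\<close>). The induction starts with the integer multiples of \<open>1\<close>, where
  it only concerns the choice of a prime (\<open>separated_by_int_multiples\<close>). All targets are
  algebraic closures of finite fields, and in those any finitely many elements already lie in
  a finite subfield (\<open>closed_over_finite_descent\<close>).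
\<close>

section \<open>Sums-of-squares formulas and ring homomorphisms\<close>

context cring begin

lemma indexed_poly_ring_sel:
  "carrier (indexed_poly_ring R I) = (carrier R[\<X>\<^bsub>I\<^esub>])"
  "monoid.mult (indexed_poly_ring R I) = indexed_conv"
  "monoid.one (indexed_poly_ring R I) = indexed_const \<one>"
  "ring.zero (indexed_poly_ring R I) = indexed_const \<zero>"
  "ring.add (indexed_poly_ring R I) = indexed_padd"
  by (simp_all add: indexed_poly_ring_def indexed_conv_def fun_eq_iff)

lemma indexed_const_closed: "k \<in> carrier R \<Longrightarrow> indexed_const k \<in> carrier (indexed_poly_ring R I)"
  by (simp add: indexed_poly_ring_sel indexed_pset.intros)

lemma indexed_var_closed: "i \<in> I \<Longrightarrow> indexed_var i \<in> carrier (indexed_poly_ring R I)"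
  by (simp add: indexed_poly_ring_sel indexed_var_def indexed_pset.intros)

end

text \<open>A ring homomorphism applied to coefficients is a homomorphism of polynomial rings that fixes the
  variables. A sums-of-squares formula is an equation in such a ring, so it can be pushed along any
  homomorphism, and pulled back along an injective one.\<close>

context ring_hom_cring begin

lemma comp_indexed_const: "h \<circ> R.indexed_const k = S.indexed_const (h k)"
  by (auto simp: R.indexed_const_def S.indexed_const_def)

lemma comp_indexed_pmult: "h \<circ> R.indexed_pmult P i = S.indexed_pmult (h \<circ> P) i"
  by (auto simp: R.indexed_pmult_def S.indexed_pmult_def)

lemma comp_indexed_var: "h \<circ> R.indexed_var i = S.indexed_var i"
  by (simp add: R.indexed_var_def S.indexed_var_def comp_indexed_pmult comp_indexed_const)

lemma comp_indexed_padd: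
  assumes "R.carrier_coeff P" "R.carrier_coeff Q"
  shows "h \<circ> R.indexed_padd P Q = S.indexed_padd (h \<circ> P) (h \<circ> Q)"
  using assms by (auto simp: R.indexed_padd_def S.indexed_padd_def R.carrier_coeff_def)

lemma comp_indexed_pset:
  assumes "P \<in> R.indexed_pset I (carrier R)"
  shows "h \<circ> P \<in> S.indexed_pset I (carrier S)"
  using assms
proof induction
  case (indexed_const k)
  then show ?case by (simp add: comp_indexed_const S.indexed_pset.indexed_const)
next
  case (indexed_padd P Q)
  show ?case
    unfolding comp_indexed_padd[OF indexed_padd.hyps[THEN R.indexed_pset_coeff]]
    by (rule S.indexed_pset.indexed_padd[OF indexed_padd.IH])
next
  case (indexed_pmult P i)
  show ?case
    unfolding comp_indexed_pmult
    by (rule S.indexed_pset.indexed_pmult[OF indexed_pmult.IH indexed_pmult.hyps(2)])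
qed

lemma comp_indexed_conv:
  assumes "R.carrier_coeff P" "R.carrier_coeff Q"
  shows "h \<circ> R.indexed_conv P Q = S.indexed_conv (h \<circ> P) (h \<circ> Q)"
proof
  fix m
  have "(\<lambda>u. P u \<otimes> Q (m - u)) \<in> {u. u \<subseteq># m} \<rightarrow> carrier R"
    using assms by (auto simp: R.carrier_coeff_def)
  then show "(h \<circ> R.indexed_conv P Q) m = S.indexed_conv (h \<circ> P) (h \<circ> Q) m"
    using assms unfolding R.indexed_conv_def S.indexed_conv_def R.carrier_coeff_def
    by (auto intro!: S.finsum_cong')
qed

lemma indexed_poly_ring_hom:
  "ring_hom_cring (indexed_poly_ring R I) (indexed_poly_ring S I) ((\<circ>) h)"
proof (intro ring_hom_cring.intro ring_hom_cring_axioms.intro ring_hom_memI)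
  show "cring (indexed_poly_ring R I)" by (rule R.indexed_poly_ring_cring)
  show "cring (indexed_poly_ring S I)" by (rule S.indexed_poly_ring_cring)
qed (simp_all add: R.indexed_poly_ring_sel S.indexed_poly_ring_sel comp_indexed_pset
       comp_indexed_conv comp_indexed_padd comp_indexed_const R.indexed_pset_coeff)

text \<open>A separate family \<open>\<beta>\<close>, tied to \<open>\<alpha>\<close> only on the index range, lets a given formula over \<open>S\<close> be
  pulled back: outside the range its coefficients need not be values of \<open>h\<close>.\<close>
lemma sums_of_squares_formula_hom:
  assumes \<alpha>: "\<And>i j k. i \<in> {1..n} \<Longrightarrow> j \<in> {1..r} \<Longrightarrow> k \<in> {1..s} \<Longrightarrow> \<alpha> i j k \<in> carrier R"
    and \<beta>: "\<And>i j k. i \<in> {1..n} \<Longrightarrow> j \<in> {1..r} \<Longrightarrow> k \<in> {1..s} \<Longrightarrow> h (\<alpha> i j k) = \<beta> i j k"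
  shows "sums_of_squares_formula R r s n \<alpha> \<Longrightarrow> sums_of_squares_formula S r s n \<beta>"
    and "inj_on h (carrier R) \<Longrightarrow> sums_of_squares_formula S r s n \<beta> \<Longrightarrow>
           sums_of_squares_formula R r s n \<alpha>"
proof -
  let ?I = "Inl ` {1..r} \<union> Inr ` {1..s} :: (nat + nat) set"
  define P where "P = indexed_poly_ring R ?I"
  define Q where "Q = indexed_poly_ring S ?I"
  define x where "x = (\<lambda>j. R.indexed_var (Inl j :: nat + nat))"
  define y where "y = (\<lambda>k. R.indexed_var (Inr k :: nat + nat))"
  define x' where "x' = (\<lambda>j. S.indexed_var (Inl j :: nat + nat))"
  define y' where "y' = (\<lambda>k. S.indexed_var (Inr k :: nat + nat))"
  define c where "c = (\<lambda>i j k. R.indexed_const (\<alpha> i j k) :: (nat + nat) multiset \<Rightarrow> 'a)"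
  define c' where "c' = (\<lambda>i j k. S.indexed_const (\<beta> i j k) :: (nat + nat) multiset \<Rightarrow> 'c)"
  interpret H: ring_hom_cring P Q "(\<circ>) h"
    unfolding P_def Q_def by (rule indexed_poly_ring_hom)
  have hx: "h \<circ> x j = x' j" and hy: "h \<circ> y k = y' k" for j k
    by (simp_all add: x_def x'_def y_def y'_def comp_indexed_var)
  have hc: "h \<circ> c i j k = c' i j k" if "i \<in> {1..n}" "j \<in> {1..r}" "k \<in> {1..s}" for i j k
    using \<beta>[OF that] by (simp add: c_def c'_def comp_indexed_const)
  have x[simp]: "j \<in> {1..r} \<Longrightarrow> x j \<in> carrier P" and y[simp]: "k \<in> {1..s} \<Longrightarrow> y k \<in> carrier P"
    and c[simp]: "i \<in> {1..n} \<Longrightarrow> j \<in> {1..r} \<Longrightarrow> k \<in> {1..s} \<Longrightarrow> c i j k \<in> carrier P" for i j k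
    using \<alpha> by (simp_all add: P_def x_def y_def c_def R.indexed_const_closed R.indexed_var_closed)
  define LHS where "LHS = (\<Oplus>\<^bsub>P\<^esub>j\<in>{1..r}. x j [^]\<^bsub>P\<^esub> (2::nat)) \<otimes>\<^bsub>P\<^esub> (\<Oplus>\<^bsub>P\<^esub>k\<in>{1..s}. y k [^]\<^bsub>P\<^esub> (2::nat))"
  define z where "z = (\<lambda>i. \<Oplus>\<^bsub>P\<^esub>j\<in>{1..r}. \<Oplus>\<^bsub>P\<^esub>k\<in>{1..s}. c i j k \<otimes>\<^bsub>P\<^esub> (x j \<otimes>\<^bsub>P\<^esub> y k))"
  define RHS where "RHS = (\<Oplus>\<^bsub>P\<^esub>i\<in>{1..n}. z i [^]\<^bsub>P\<^esub> (2::nat))"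
  have inner: "(\<Oplus>\<^bsub>P\<^esub>k\<in>{1..s}. c i j k \<otimes>\<^bsub>P\<^esub> (x j \<otimes>\<^bsub>P\<^esub> y k)) \<in> carrier P"
    if "i \<in> {1..n}" "j \<in> {1..r}" for i j
    using that by (intro H.R.finsum_closed) (auto simp del: atLeastAtMost_iff One_nat_def)
  have z[simp]: "z i \<in> carrier P" if "i \<in> {1..n}" for i
    unfolding z_def using that inner by (intro H.R.finsum_closed) blast
  have sqx: "(\<Oplus>\<^bsub>P\<^esub>j\<in>{1..r}. x j [^]\<^bsub>P\<^esub> (2::nat)) \<in> carrier P"
    and sqy: "(\<Oplus>\<^bsub>P\<^esub>k\<in>{1..s}. y k [^]\<^bsub>P\<^esub> (2::nat)) \<in> carrier P"
    by (intro H.R.finsum_closed; auto simp del: atLeastAtMost_iff One_nat_def)+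
  have RHS: "RHS \<in> carrier P" unfolding RHS_def
    by (intro H.R.finsum_closed; auto simp del: atLeastAtMost_iff One_nat_def)
  have LHS: "LHS \<in> carrier P" unfolding LHS_def using sqx sqy by simp
  have hpow: "h \<circ> (u [^]\<^bsub>P\<^esub> (2::nat)) = (h \<circ> u) [^]\<^bsub>Q\<^esub> (2::nat)" if "u \<in> carrier P" for u
    using that by (rule H.ring.hom_nat_pow)
  have hz: "h \<circ> z i = (\<Oplus>\<^bsub>Q\<^esub>j\<in>{1..r}. \<Oplus>\<^bsub>Q\<^esub>k\<in>{1..s}. c' i j k \<otimes>\<^bsub>Q\<^esub> (x' j \<otimes>\<^bsub>Q\<^esub> y' k))"
    if "i \<in> {1..n}" for i
  proof -
    have "h \<circ> z i = (\<Oplus>\<^bsub>Q\<^esub>j\<in>{1..r}. h \<circ> (\<Oplus>\<^bsub>P\<^esub>k\<in>{1..s}. c i j k \<otimes>\<^bsub>P\<^esub> (x j \<otimes>\<^bsub>P\<^esub> y k)))"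
      unfolding z_def using that inner by (subst H.hom_finsum) (auto simp: comp_def[of "(\<circ>) h"])
    also have "\<dots> = (\<Oplus>\<^bsub>Q\<^esub>j\<in>{1..r}. \<Oplus>\<^bsub>Q\<^esub>k\<in>{1..s}. c' i j k \<otimes>\<^bsub>Q\<^esub> (x' j \<otimes>\<^bsub>Q\<^esub> y' k))"
    proof (intro H.S.finsum_cong')
      fix j assume j: "j \<in> {1..r}"
      have "h \<circ> (\<Oplus>\<^bsub>P\<^esub>k\<in>{1..s}. c i j k \<otimes>\<^bsub>P\<^esub> (x j \<otimes>\<^bsub>P\<^esub> y k))
          = (\<Oplus>\<^bsub>Q\<^esub>k\<in>{1..s}. h \<circ> (c i j k \<otimes>\<^bsub>P\<^esub> (x j \<otimes>\<^bsub>P\<^esub> y k)))"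
        using that j
        by (subst H.hom_finsum) (auto simp: comp_def[of "(\<circ>) h"] simp del: atLeastAtMost_iff One_nat_def)
      also have "\<dots> = (\<Oplus>\<^bsub>Q\<^esub>k\<in>{1..s}. c' i j k \<otimes>\<^bsub>Q\<^esub> (x' j \<otimes>\<^bsub>Q\<^esub> y' k))"
        using that j by (intro H.S.finsum_cong')
          (auto simp: hx[symmetric] hy[symmetric] hc[symmetric] simp del: atLeastAtMost_iff One_nat_def)
      finally show "h \<circ> (\<Oplus>\<^bsub>P\<^esub>k\<in>{1..s}. c i j k \<otimes>\<^bsub>P\<^esub> (x j \<otimes>\<^bsub>P\<^esub> y k))
         = (\<Oplus>\<^bsub>Q\<^esub>k\<in>{1..s}. c' i j k \<otimes>\<^bsub>Q\<^esub> (x' j \<otimes>\<^bsub>Q\<^esub> y' k))" .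
    next
      show "(\<lambda>j. \<Oplus>\<^bsub>Q\<^esub>k\<in>{1..s}. c' i j k \<otimes>\<^bsub>Q\<^esub> (x' j \<otimes>\<^bsub>Q\<^esub> y' k)) \<in> {1..r} \<rightarrow> carrier Q"
        using that by (intro Pi_I H.S.finsum_closed)
          (auto simp: hx[symmetric] hy[symmetric] hc[symmetric] simp del: atLeastAtMost_iff One_nat_def)
    qed simp
    finally show ?thesis .
  qed
  have hLHS: "h \<circ> LHS = (\<Oplus>\<^bsub>Q\<^esub>j\<in>{1..r}. x' j [^]\<^bsub>Q\<^esub> (2::nat)) \<otimes>\<^bsub>Q\<^esub> (\<Oplus>\<^bsub>Q\<^esub>k\<in>{1..s}. y' k [^]\<^bsub>Q\<^esub> (2::nat))"
  proof -
    have "h \<circ> (\<Oplus>\<^bsub>P\<^esub>j\<in>{1..r}. x j [^]\<^bsub>P\<^esub> (2::nat)) = (\<Oplus>\<^bsub>Q\<^esub>j\<in>{1..r}. x' j [^]\<^bsub>Q\<^esub> (2::nat))"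
      by (subst H.hom_finsum)
        (auto simp: hx[symmetric] hpow simp del: atLeastAtMost_iff intro!: H.S.finsum_cong')
    moreover have "h \<circ> (\<Oplus>\<^bsub>P\<^esub>k\<in>{1..s}. y k [^]\<^bsub>P\<^esub> (2::nat)) = (\<Oplus>\<^bsub>Q\<^esub>k\<in>{1..s}. y' k [^]\<^bsub>Q\<^esub> (2::nat))"
      by (subst H.hom_finsum)
        (auto simp: hy[symmetric] hpow simp del: atLeastAtMost_iff intro!: H.S.finsum_cong')
    ultimately show ?thesis unfolding LHS_def using sqx sqy by simp
  qed
  have hRHS: "h \<circ> RHS = (\<Oplus>\<^bsub>Q\<^esub>i\<in>{1..n}. (\<Oplus>\<^bsub>Q\<^esub>j\<in>{1..r}. \<Oplus>\<^bsub>Q\<^esub>k\<in>{1..s}. c' i j k \<otimes>\<^bsub>Q\<^esub> (x' j \<otimes>\<^bsub>Q\<^esub> y' k)) [^]\<^bsub>Q\<^esub> (2::nat))"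
    unfolding RHS_def
    by (subst H.hom_finsum)
      (auto simp: hz[symmetric] hpow simp del: atLeastAtMost_iff One_nat_def intro!: H.S.finsum_cong')
  have R: "sums_of_squares_formula R r s n \<alpha> \<longleftrightarrow> LHS = RHS"
    unfolding sums_of_squares_formula_def Let_def LHS_def RHS_def z_def P_def x_def y_def c_def
    using \<alpha> by blast
  have S: "sums_of_squares_formula S r s n \<beta> \<longleftrightarrow> h \<circ> LHS = h \<circ> RHS"
    unfolding sums_of_squares_formula_def Let_def hLHS hRHS Q_def x'_def y'_def c'_def
    using \<alpha> \<beta> hom_closed by metis
  show "sums_of_squares_formula R r s n \<alpha> \<Longrightarrow> sums_of_squares_formula S r s n \<beta>"
    unfolding R S by simp
  show "sums_of_squares_formula R r s n \<alpha>"
    if inj: "inj_on h (carrier R)" and "sums_of_squares_formula S r s n \<beta>"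
  proof -
    have "R.carrier_coeff LHS" "R.carrier_coeff RHS"
      using LHS RHS R.indexed_pset_coeff unfolding P_def R.indexed_poly_ring_sel by blast+
    then show ?thesis
      using that(2) inj unfolding R S R.carrier_coeff_def inj_on_def fun_eq_iff comp_def by blast
  qed
qed

end

section \<open>Evaluation of coefficient lists\<close>

context ring begin

lemma eval_map_mult:
  assumes "set p \<subseteq> carrier R" "c \<in> carrier R" "x \<in> carrier R"
  shows "eval (map ((\<otimes>) c) p) x = c \<otimes> eval p x"
  using assms by (induction p) (auto simp: r_distr m_assoc eval_in_carrier)

lemma eval_zeros:
  assumes "\<forall>u\<in>set p. u = \<zero>" "x \<in> carrier R"
  shows "eval p x = \<zero>"
  using assms by (induction p) auto

lemma eval_append_zeros:
  assumes "set p \<subseteq> carrier R" "x \<in> carrier R"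
  shows "eval (p @ replicate n \<zero>) x = eval p x \<otimes> x [^] n"
  using assms eval_zeros[of "replicate n \<zero>" x]
  by (subst eval_append) (auto simp: eval_in_carrier)

lemma normalize_eq_Nil: "normalize p = [] \<Longrightarrow> u \<in> set p \<Longrightarrow> u = \<zero>"
  by (induction p) (auto split: if_splits)

lemma simple_extension_eval:
  assumes "set p \<subseteq> K" "K \<subseteq> carrier R" "x \<in> carrier R"
  shows "eval p x \<in> simple_extension K x"
proof -
  have "normalize p \<in> carrier (K[X])"
    using normalize_gives_polynomial[OF assms(1)] by (simp add: univ_poly_carrier)
  moreover have "eval (normalize p) x = eval p x"
    using assms by (intro eval_normalize) auto
  ultimately show ?thesis
    unfolding simple_extension_as_eval_img[OF assms(2,3)] by (intro image_eqI) auto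
qed

lemma simple_extension_evalE:
  assumes "y \<in> simple_extension K x" "K \<subseteq> carrier R" "x \<in> carrier R"
  obtains p where "p \<in> carrier (K[X])" "set p \<subseteq> K" "y = eval p x"
proof -
  obtain p where p: "p \<in> carrier (K[X])" "y = eval p x"
    using assms unfolding simple_extension_as_eval_img[OF assms(2,3)] by blast
  then have "set p \<subseteq> K" using polynomial_incl by (simp add: univ_poly_carrier[symmetric])
  with p show thesis using that by blast
qed

end

text \<open>This will be used in the product of two fields, which is not a domain, so that
  \<open>simple_extension_is_subring\<close> does not apply.\<close>
lemma (in cring) simple_extension_subring:
  assumes K: "subring K R" and x: "x \<in> carrier R"
  shows "subring (simple_extension K x) R"
proof -
  note K_simps = subringE[OF K]
  have sub: "simple_extension K x \<subseteq> carrier R"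
    using K_simps(1) x by (rule simple_extension_in_carrier)
  have add: "u \<oplus> v \<in> simple_extension K x"
    if "u \<in> simple_extension K x" "v \<in> simple_extension K x" for u v
    using that
  proof (induction arbitrary: v)
    case zero
    then show ?case using sub by auto
  next
    case (lin k1 k2)
    show ?case using lin.prems
    proof cases
      case zero
      have "k1 \<otimes> x \<oplus> k2 \<in> simple_extension K x"
        using lin.hyps by (rule simple_extension.lin)
      then show ?thesis using zero sub by auto
    next
      case v: (lin l1 l2)
      have c: "k1 \<in> carrier R" "l1 \<in> carrier R" "k2 \<in> carrier R" "l2 \<in> carrier R"
        using lin.hyps v(2,3) sub K_simps(1) by blast+
      have "k1 \<otimes> x \<oplus> k2 \<oplus> v = (k1 \<oplus> l1) \<otimes> x \<oplus> (k2 \<oplus> l2)"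
        using c x unfolding v(1) by algebra
      moreover have "k1 \<oplus> l1 \<in> simple_extension K x" using lin.IH v by blast
      ultimately show ?thesis
        using simple_extension.lin[of "k1 \<oplus> l1" K x "k2 \<oplus> l2"] K_simps(7) lin.hyps v by simp
    qed
  qed
  have scale: "k \<otimes> u \<in> simple_extension K x" if "u \<in> simple_extension K x" "k \<in> K" for u k
    using that
  proof induction
    case zero
    then show ?case using K_simps(1) by auto
  next
    case (lin k1 k2)
    have c: "k1 \<in> carrier R" "k2 \<in> carrier R" "k \<in> carrier R"
      using lin.hyps lin.prems sub K_simps(1) by blast+
    have "k \<otimes> (k1 \<otimes> x \<oplus> k2) = (k \<otimes> k1) \<otimes> x \<oplus> k \<otimes> k2"
      using c x by algebra
    then show ?case
      using simple_extension.lin[of "k \<otimes> k1" K x "k \<otimes> k2"] lin K_simps(6) by simp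
  qed
  have mult: "u \<otimes> v \<in> simple_extension K x"
    if "u \<in> simple_extension K x" "v \<in> simple_extension K x" for u v
    using that
  proof induction
    case zero
    then show ?case using sub by auto
  next
    case (lin k1 k2)
    have c: "k1 \<in> carrier R" "k2 \<in> carrier R" "v \<in> carrier R"
      using lin.hyps lin.prems sub K_simps(1) by blast+
    have "(k1 \<otimes> x \<oplus> k2) \<otimes> v = ((k1 \<otimes> v) \<otimes> x \<oplus> \<zero>) \<oplus> k2 \<otimes> v"
      using c x by algebra
    moreover have "(k1 \<otimes> v) \<otimes> x \<oplus> \<zero> \<in> simple_extension K x"
      using lin K_simps(2) by (intro simple_extension.lin) auto
    ultimately show ?case
      using add scale[of v k2] lin.hyps(2) lin.prems by simp
  qed
  have one: "\<one> \<in> simple_extension K x"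
    using simple_extension_incl[OF K_simps(1) x] K_simps(3) by blast
  have "\<ominus> u \<in> simple_extension K x" if "u \<in> simple_extension K x" for u
  proof -
    have "\<ominus> u = (\<ominus> \<one>) \<otimes> u" using that sub by (auto simp: l_minus)
    then show ?thesis using scale[OF that] K_simps(3,5) by simp
  qed
  then show ?thesis using sub one add mult by (intro subringI) auto
qed

section \<open>Algebraic elements over a subring of a field\<close>

context field begin

lemma generate_field_denominator:
  assumes A: "subring A R" and "x \<in> generate_field R A"
  shows "\<exists>d\<in>A - {\<zero>}. d \<otimes> x \<in> A"
proof -
  note A_simps = subringE[OF A]
  have car: "y \<in> generate_field R A \<Longrightarrow> y \<in> carrier R" for y
    using generate_field_incl[OF A_simps(1)] by blast
  show ?thesis
    using assms(2)
  proof induction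
    case one
    show ?case using A_simps(3) by (intro bexI[of _ \<one>]) auto
  next
    case (incl y)
    then show ?case using A_simps(1,3) by (intro bexI[of _ \<one>]) auto
  next
    case (a_inv y)
    then obtain d where "d \<in> A - {\<zero>}" "d \<otimes> y \<in> A" by blast
    moreover from this have "d \<otimes> (\<ominus> y) = \<ominus> (d \<otimes> y)" using A_simps(1) car a_inv by (auto simp: r_minus)
    ultimately show ?case using A_simps(5) by (intro bexI[of _ d]) auto
  next
    case (m_inv y)
    then obtain d where d: "d \<in> A - {\<zero>}" "d \<otimes> y \<in> A" by blast
    have c: "d \<in> carrier R" "y \<in> carrier R" "y \<in> Units R"
      using d A_simps(1) car m_inv field_Units by auto
    have "(d \<otimes> y) \<otimes> inv y = d" using c by (simp add: m_assoc)
    moreover have "d \<otimes> y \<noteq> \<zero>" using d m_inv c integral by blast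
    ultimately show ?case using d by (intro bexI[of _ "d \<otimes> y"]) auto
  next
    case (eng_add y z)
    then obtain d e where d: "d \<in> A - {\<zero>}" "d \<otimes> y \<in> A" and e: "e \<in> A - {\<zero>}" "e \<otimes> z \<in> A" by blast
    have c: "d \<in> carrier R" "e \<in> carrier R" "y \<in> carrier R" "z \<in> carrier R"
      using d e A_simps(1) car eng_add by auto
    have "(d \<otimes> e) \<otimes> (y \<oplus> z) = e \<otimes> (d \<otimes> y) \<oplus> d \<otimes> (e \<otimes> z)" using c by algebra
    then have "(d \<otimes> e) \<otimes> (y \<oplus> z) \<in> A" using d e A_simps(6,7) by simp
    moreover have "d \<otimes> e \<in> A - {\<zero>}" using d e c A_simps(6) integral by blast
    ultimately show ?case by blast
  next
    case (eng_mult y z)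
    then obtain d e where d: "d \<in> A - {\<zero>}" "d \<otimes> y \<in> A" and e: "e \<in> A - {\<zero>}" "e \<otimes> z \<in> A" by blast
    have c: "d \<in> carrier R" "e \<in> carrier R" "y \<in> carrier R" "z \<in> carrier R"
      using d e A_simps(1) car eng_mult by auto
    have "(d \<otimes> e) \<otimes> (y \<otimes> z) = (d \<otimes> y) \<otimes> (e \<otimes> z)" using c by algebra
    then have "(d \<otimes> e) \<otimes> (y \<otimes> z) \<in> A" using d e A_simps(6) by simp
    moreover have "d \<otimes> e \<in> A - {\<zero>}" using d e c A_simps(6) integral by blast
    ultimately show ?case by blast
  qed
qed

lemma simple_extension_denominator:
  assumes A: "subring A R" and b: "b \<in> carrier R" and "y \<in> simple_extension (generate_field R A) b"
  shows "\<exists>d\<in>A - {\<zero>}. d \<otimes> y \<in> simple_extension A b"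
  using assms(3)
proof induction
  case zero
  then show ?case using subringE(1,3)[OF A] by (intro bexI[of _ \<one>]) auto
next
  case (lin k1 k2)
  note A_simps = subringE[OF A]
  have sub: "subring (simple_extension A b) R" by (rule simple_extension_is_subring[OF A b])
  have incl: "A \<subseteq> simple_extension A b" by (rule simple_extension_incl[OF A_simps(1) b])
  have K: "generate_field R A \<subseteq> carrier R" by (rule generate_field_incl[OF A_simps(1)])
  obtain d e where d: "d \<in> A - {\<zero>}" "d \<otimes> k1 \<in> simple_extension A b"
    and e: "e \<in> A - {\<zero>}" "e \<otimes> k2 \<in> A"
    using lin.IH generate_field_denominator[OF A lin.hyps(2)] by blast
  have c: "d \<in> carrier R" "e \<in> carrier R" "k1 \<in> carrier R" "k2 \<in> carrier R"
    using d e A_simps(1) lin.hyps K simple_extension_in_carrier[OF K b] by auto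
  have "(d \<otimes> e) \<otimes> (k1 \<otimes> b \<oplus> k2) = (e \<otimes> (d \<otimes> k1)) \<otimes> b \<oplus> d \<otimes> (e \<otimes> k2)" using c b by algebra
  moreover have "e \<otimes> (d \<otimes> k1) \<in> simple_extension A b" using d e incl subringE(6)[OF sub] by blast
  moreover have "d \<otimes> (e \<otimes> k2) \<in> A" using d e A_simps(6) by blast
  ultimately have "(d \<otimes> e) \<otimes> (k1 \<otimes> b \<oplus> k2) \<in> simple_extension A b"
    using simple_extension.lin[of "e \<otimes> (d \<otimes> k1)" A b "d \<otimes> (e \<otimes> k2)"] by simp
  moreover have "d \<otimes> e \<in> A - {\<zero>}" using d e c A_simps(6) integral by blast
  ultimately show ?case by blast
qed

text \<open>Over the field of fractions \<open>K\<close> of \<open>A\<close>, adjoining the algebraic element \<open>b\<close> gives a field, so the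
  inverse of \<open>y\<close> is a polynomial in \<open>b\<close> over \<open>K\<close>. Clearing its denominators gives \<open>z\<close>. This is how
  "\<open>y\<close> is not killed" is reduced to a condition on elements of \<open>A\<close>.\<close>
lemma algebraic_divides_nonzero_constant:
  assumes A: "subring A R" and b: "b \<in> carrier R" and alg: "(algebraic over A) b"
    and y: "y \<in> simple_extension A b" "y \<noteq> \<zero>"
  obtains z where "z \<in> simple_extension A b" "y \<otimes> z \<in> A - {\<zero>}"
proof -
  let ?K = "generate_field R A"
  have Ac: "A \<subseteq> carrier R" by (rule subringE(1)[OF A])
  have K: "subfield ?K R" by (rule generate_field_is_subfield[OF Ac])
  have AK: "A \<subseteq> ?K" by (rule subsetI) (rule generate_field.incl)
  have sf: "subfield (simple_extension ?K b) R"
    using simple_extension_is_subfield[OF K b] algebraic_mono[OF AK alg] by simp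
  moreover have "y \<in> simple_extension ?K b" using subsetD[OF mono_simple_extension[OF AK] y(1)] .
  ultimately have "inv y \<in> simple_extension ?K b" using y(2) subfield_m_inv(1)[of _ y] by simp
  then obtain d where d: "d \<in> A - {\<zero>}" "d \<otimes> inv y \<in> simple_extension A b"
    using simple_extension_denominator[OF A b] by blast
  have c: "y \<in> Units R" "d \<in> carrier R" "y \<in> carrier R"
    using d(1) Ac y simple_extension_in_carrier[OF Ac b] field_Units by auto
  have "y \<otimes> (d \<otimes> inv y) = d" using c by (simp add: m_lcomm)
  with d that show thesis by metis
qed

end

lemma (in algebraically_closed) has_root:
  assumes p: "p \<in> carrier (poly_ring L)" and "degree p > 0"
  obtains x where "x \<in> carrier L" "eval p x = \<zero>"
proof -
  have "size (roots p) > 0" using roots_over_carrier[OF p] assms(2) by (simp add: splitted_def)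
  then have "roots p \<noteq> {#}" by auto
  then obtain x where "x \<in># roots p" by blast
  then show thesis using that roots_mem_iff_is_root[OF p] by (auto simp: is_root_def)
qed

section \<open>Partial homomorphisms between fields\<close>

lemma RDirProd_sel:
  "carrier (RDirProd F L) = carrier F \<times> carrier L"
  "u \<otimes>\<^bsub>RDirProd F L\<^esub> v = (fst u \<otimes>\<^bsub>F\<^esub> fst v, snd u \<otimes>\<^bsub>L\<^esub> snd v)"
  "u \<oplus>\<^bsub>RDirProd F L\<^esub> v = (fst u \<oplus>\<^bsub>F\<^esub> fst v, snd u \<oplus>\<^bsub>L\<^esub> snd v)"
  "\<one>\<^bsub>RDirProd F L\<^esub> = (\<one>\<^bsub>F\<^esub>, \<one>\<^bsub>L\<^esub>)"
  "\<zero>\<^bsub>RDirProd F L\<^esub> = (\<zero>\<^bsub>F\<^esub>, \<zero>\<^bsub>L\<^esub>)"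
  by (auto simp: RDirProd_def DirProd_def monoid.defs split: prod.splits)

text \<open>A homomorphism from a subring of \<open>F\<close> to \<open>L\<close>, given by its graph \<open>G\<close>; the domain is \<open>fst ` G\<close>, and the
  second conjunct makes the relation single-valued. With graphs, extending the homomorphism by
  \<open>b \<mapsto> t\<close> is adjoining \<open>(b, t)\<close> to a subring of \<open>F \<times> L\<close>, and computing with a polynomial and its image
  at the same time is computing in that one ring.\<close>
definition partial_hom :: "('a, 'c) ring_scheme \<Rightarrow> ('b, 'd) ring_scheme \<Rightarrow> ('a \<times> 'b) set \<Rightarrow> bool"
  where "partial_hom F L G \<longleftrightarrow>
    subring G (RDirProd F L) \<and> (\<forall>y. (\<zero>\<^bsub>F\<^esub>, y) \<in> G \<longrightarrow> y = \<zero>\<^bsub>L\<^esub>)"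

locale field_pair = F: field F + L: field L
  for F :: "('a, 'c) ring_scheme" and L :: "('b, 'd) ring_scheme"
begin

abbreviation "FL \<equiv> RDirProd F L"

sublocale FL: cring FL
proof (rule cring.intro)
  show "ring FL" by (rule RDirProd_ring[OF F.ring_axioms L.ring_axioms])
  then interpret ring FL .
  show "comm_monoid FL"
    by (rule comm_monoidI) (auto simp: RDirProd_sel F.m_assoc L.m_assoc F.m_comm L.m_comm F.m_lcomm L.m_lcomm)
qed

sublocale fst: ring_hom_cring FL F fst
  by unfold_locales (auto simp: ring_hom_def RDirProd_sel)

sublocale snd: ring_hom_cring FL L snd
  by unfold_locales (auto simp: ring_hom_def RDirProd_sel)

lemma eval_pair:
  assumes "set g \<subseteq> carrier FL" "b \<in> carrier F" "t \<in> carrier L"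
  shows "FL.eval g (b, t) = (F.eval (map fst g) b, L.eval (map snd g) t)"
  using fst.ring.eval_hom'[of "(b, t)" g] snd.ring.eval_hom'[of "(b, t)" g] assms
  by (auto simp: RDirProd_sel prod_eq_iff)

lemma partial_hom_carrier: "partial_hom F L G \<Longrightarrow> G \<subseteq> carrier FL"
  using subringE(1) unfolding partial_hom_def by blast

lemma partial_hom_unique:
  assumes "partial_hom F L G" "(a, u) \<in> G" "(a, v) \<in> G"
  shows "u = v"
proof -
  have G: "subring G FL" using assms(1) by (simp add: partial_hom_def)
  have c: "(a, u) \<in> carrier FL" "(a, v) \<in> carrier FL"
    using assms partial_hom_carrier by blast+
  have "(a, u) \<oplus>\<^bsub>FL\<^esub> (\<ominus>\<^bsub>FL\<^esub> (a, v)) \<in> G" using subringE(5,7)[OF G] assms(2,3) by blast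
  moreover have "(a, u) \<oplus>\<^bsub>FL\<^esub> (\<ominus>\<^bsub>FL\<^esub> (a, v)) = (\<zero>\<^bsub>F\<^esub>, u \<ominus>\<^bsub>L\<^esub> v)"
    using c fst.hom_a_inv[of "(a, v)"] snd.hom_a_inv[of "(a, v)"]
    by (auto simp: prod_eq_iff RDirProd_sel F.r_neg L.minus_eq)
  ultimately have "u \<ominus>\<^bsub>L\<^esub> v = \<zero>\<^bsub>L\<^esub>" using assms(1) by (simp add: partial_hom_def)
  then show ?thesis using c by (simp add: RDirProd_sel)
qed

text \<open>The elements of the extended graph are the values \<open>g(b, t)\<close>. One of them lies over \<open>0\<close> exactly if
  \<open>g\<close> gives a relation of \<open>b\<close>, so the graph stays single-valued if \<open>t\<close> satisfies the images of the
  relations of \<open>b\<close>.\<close>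
lemma partial_hom_extend:
  assumes G: "partial_hom F L G" and b: "b \<in> carrier F" and t: "t \<in> carrier L"
    and compat: "\<And>g. set g \<subseteq> G \<Longrightarrow> F.eval (map fst g) b = \<zero>\<^bsub>F\<^esub> \<Longrightarrow> L.eval (map snd g) t = \<zero>\<^bsub>L\<^esub>"
  shows "partial_hom F L (FL.simple_extension G (b, t))"
proof -
  have bt: "(b, t) \<in> carrier FL" using b t by (simp add: RDirProd_sel)
  have sG: "subring G FL" using G by (simp add: partial_hom_def)
  have "y = \<zero>\<^bsub>L\<^esub>" if y: "(\<zero>\<^bsub>F\<^esub>, y) \<in> FL.simple_extension G (b, t)" for y
  proof -
    obtain g where g: "set g \<subseteq> G" "(\<zero>\<^bsub>F\<^esub>, y) = FL.eval g (b, t)"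
      using FL.simple_extension_evalE[OF y partial_hom_carrier[OF G] bt] by metis
    then show ?thesis
      using compat[of g] eval_pair[of g b t] b t partial_hom_carrier[OF G] by auto
  qed
  then show ?thesis
    using FL.simple_extension_subring[OF sG bt] by (simp add: partial_hom_def)
qed

lemma fst_simple_extension: "fst ` FL.simple_extension G (b, t) = F.simple_extension (fst ` G) b"
proof (intro equalityI subsetI)
  fix y assume "y \<in> fst ` FL.simple_extension G (b, t)"
  then obtain v where "v \<in> FL.simple_extension G (b, t)" "y = fst v" by blast
  then show "y \<in> F.simple_extension (fst ` G) b"
  proof (induction arbitrary: y)
    case (lin k1 k2)
    then have "fst k1 \<otimes>\<^bsub>F\<^esub> b \<oplus>\<^bsub>F\<^esub> fst k2 \<in> F.simple_extension (fst ` G) b"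
      by (intro F.simple_extension.lin) auto
    then show ?case using lin.prems by (simp add: RDirProd_sel)
  qed (simp add: RDirProd_sel)
next
  fix y assume "y \<in> F.simple_extension (fst ` G) b"
  then show "y \<in> fst ` FL.simple_extension G (b, t)"
  proof induction
    case zero
    have "\<zero>\<^bsub>FL\<^esub> \<in> FL.simple_extension G (b, t)" by (rule FL.simple_extension.zero)
    then show ?case by (force simp: RDirProd_sel)
  next
    case (lin k1 k2)
    then obtain u v where "u \<in> FL.simple_extension G (b, t)" "fst u = k1" "v \<in> G" "fst v = k2"
      by blast
    moreover from this have "u \<otimes>\<^bsub>FL\<^esub> (b, t) \<oplus>\<^bsub>FL\<^esub> v \<in> FL.simple_extension G (b, t)"
      by (intro FL.simple_extension.lin)
    ultimately show ?case by (force simp: RDirProd_sel)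
  qed
qed

lemma list_lift:
  assumes "set g \<subseteq> fst ` G"
  obtains g' where "set g' \<subseteq> G" "map fst g' = g"
proof -
  have "\<exists>g'. set g' \<subseteq> G \<and> map fst g' = g"
    using assms
  proof (induction g)
    case (Cons a g)
    then obtain g' u where "set g' \<subseteq> G" "map fst g' = g" "u \<in> G" "fst u = a" by auto
    then show ?case by (intro exI[of _ "u # g'"]) auto
  qed simp
  then show thesis using that by blast
qed

text \<open>If \<open>c # f\<close> represents a nonzero relation for \<open>b\<close> of least degree, its image vanishes at \<open>t\<close>, and the
  image of its leading coefficient \<open>c\<close> is nonzero, then all relations of \<open>b\<close> pass to \<open>t\<close>. This is
  pseudo-division: a longer relation \<open>g\<close> with leading coefficient \<open>a\<close> is replaced by the shorter
  \<open>c g - a X\<^sup>k (c # f)\<close>, which still vanishes at \<open>b\<close>; if it vanishes at \<open>t\<close>, so does \<open>g\<close>, because the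
  image of \<open>c\<close> can be cancelled in \<open>L\<close>.\<close>
lemma relations_transfer_from_minimal:
  assumes G: "partial_hom F L G" and b: "b \<in> carrier F" and t: "t \<in> carrier L"
    and cf: "set (c # f) \<subseteq> G"
    and root_b: "F.eval (map fst (c # f)) b = \<zero>\<^bsub>F\<^esub>"
    and root_t: "L.eval (map snd (c # f)) t = \<zero>\<^bsub>L\<^esub>"
    and lead: "snd c \<noteq> \<zero>\<^bsub>L\<^esub>"
    and minimal: "\<And>g. set g \<subseteq> G \<Longrightarrow> length g \<le> length f \<Longrightarrow> F.eval (map fst g) b = \<zero>\<^bsub>F\<^esub> \<Longrightarrow>
                    \<forall>u\<in>set g. fst u = \<zero>\<^bsub>F\<^esub>"
    and g: "set g \<subseteq> G" "F.eval (map fst g) b = \<zero>\<^bsub>F\<^esub>"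
  shows "L.eval (map snd g) t = \<zero>\<^bsub>L\<^esub>"
  using g
proof (induction "length g" arbitrary: g rule: less_induct)
  case less
  note GC = partial_hom_carrier[OF G]
  have sG: "subring G FL" using G by (simp add: partial_hom_def)
  show ?case
  proof (cases "length g \<le> length f")
    case True
    have "snd u = \<zero>\<^bsub>L\<^esub>" if "u \<in> set g" for u
    proof -
      have "(\<zero>\<^bsub>F\<^esub>, snd u) \<in> G" using minimal[OF less.prems(1) True less.prems(2)] that less.prems(1)
        by (metis prod.collapse subsetD)
      then show ?thesis using G by (simp add: partial_hom_def)
    qed
    then show ?thesis using t by (intro L.eval_zeros) auto
  next
    case False
    then obtain a g' where g': "g = a # g'" by (cases g) auto
    define k where "k = length g' - length f"
    have len: "length g' = length f + k" using False by (simp add: k_def g')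
    let ?x = "(b, t)"
    have x: "?x \<in> carrier FL" using b t by (simp add: RDirProd_sel)
    \<comment> \<open>\<open>p\<close> and \<open>q\<close> are \<open>c g\<close> and \<open>- a X\<^sup>k (c # f)\<close> without their leading terms, which cancel.\<close>
    define p where "p = map ((\<otimes>\<^bsub>FL\<^esub>) c) g'"
    define q where "q = map ((\<otimes>\<^bsub>FL\<^esub>) (\<ominus>\<^bsub>FL\<^esub> a)) (f @ replicate k \<zero>\<^bsub>FL\<^esub>)"
    define d where "d = FL.poly_add p q"
    have sets: "set g' \<subseteq> G" "a \<in> G" "c \<in> G" "set f \<subseteq> G" using less.prems(1) cf by (auto simp: g')
    have car: "set g' \<subseteq> carrier FL" "a \<in> carrier FL" "c \<in> carrier FL" "set f \<subseteq> carrier FL"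
      using sets GC by blast+
    have "c \<otimes>\<^bsub>FL\<^esub> u \<in> G" if "u \<in> set g'" for u
      using that sets subringE(6)[OF sG] by blast
    then have pG: "set p \<subseteq> G" unfolding p_def set_map by blast
    have "(\<ominus>\<^bsub>FL\<^esub> a) \<otimes>\<^bsub>FL\<^esub> u \<in> G" if "u \<in> set (f @ replicate k \<zero>\<^bsub>FL\<^esub>)" for u
    proof -
      have "u \<in> G" using that sets(4) subringE(2)[OF sG] by (auto split: if_splits)
      then show ?thesis using sets(2) subringE(5,6)[OF sG] by blast
    qed
    then have qG: "set q \<subseteq> G" unfolding q_def set_map by blast
    have dG: "set d \<subseteq> G"
      using FL.polynomial_incl[OF FL.poly_add_is_polynomial[OF sG pG qG]] by (simp add: d_def)
    have "length d \<le> length g'"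
      using FL.poly_add_length_le[of p q] by (simp add: d_def p_def q_def len)
    then have short: "length d < length g" by (simp add: g')
    have "FL.eval d ?x = c \<otimes>\<^bsub>FL\<^esub> FL.eval g' ?x \<oplus>\<^bsub>FL\<^esub> (\<ominus>\<^bsub>FL\<^esub> a) \<otimes>\<^bsub>FL\<^esub> (FL.eval f ?x \<otimes>\<^bsub>FL\<^esub> ?x [^]\<^bsub>FL\<^esub> k)"
    proof -
      have "FL.eval d ?x = FL.eval p ?x \<oplus>\<^bsub>FL\<^esub> FL.eval q ?x"
        unfolding d_def using pG qG GC x by (intro FL.eval_poly_add) auto
      moreover have "FL.eval p ?x = c \<otimes>\<^bsub>FL\<^esub> FL.eval g' ?x"
        unfolding p_def using car x by (intro FL.eval_map_mult)
      moreover have "FL.eval q ?x = (\<ominus>\<^bsub>FL\<^esub> a) \<otimes>\<^bsub>FL\<^esub> FL.eval (f @ replicate k \<zero>\<^bsub>FL\<^esub>) ?x"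
        unfolding q_def using car x by (intro FL.eval_map_mult) auto
      moreover have "FL.eval (f @ replicate k \<zero>\<^bsub>FL\<^esub>) ?x = FL.eval f ?x \<otimes>\<^bsub>FL\<^esub> ?x [^]\<^bsub>FL\<^esub> k"
        using car x by (intro FL.eval_append_zeros)
      ultimately show ?thesis by simp
    qed
    also have "\<dots> = c \<otimes>\<^bsub>FL\<^esub> FL.eval g ?x \<ominus>\<^bsub>FL\<^esub> (a \<otimes>\<^bsub>FL\<^esub> ?x [^]\<^bsub>FL\<^esub> k) \<otimes>\<^bsub>FL\<^esub> FL.eval (c # f) ?x"
    proof -
      define xf where "xf = ?x [^]\<^bsub>FL\<^esub> length f"
      define xk where "xk = ?x [^]\<^bsub>FL\<^esub> k"
      define eg where "eg = FL.eval g' ?x"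
      define ef where "ef = FL.eval f ?x"
      have c: "xf \<in> carrier FL" "xk \<in> carrier FL" "eg \<in> carrier FL" "ef \<in> carrier FL"
        using x car unfolding xf_def xk_def eg_def ef_def
        by (auto intro: FL.eval_in_carrier simp del: fst.ring.hom_nat_pow)
      have "FL.eval g ?x = a \<otimes>\<^bsub>FL\<^esub> (xf \<otimes>\<^bsub>FL\<^esub> xk) \<oplus>\<^bsub>FL\<^esub> eg"
        using x by (simp add: g' len xf_def xk_def eg_def FL.nat_pow_mult)
      moreover have "FL.eval (c # f) ?x = c \<otimes>\<^bsub>FL\<^esub> xf \<oplus>\<^bsub>FL\<^esub> ef"
        by (simp add: xf_def ef_def)
      ultimately show ?thesis
        using c car(2,3) unfolding xf_def[symmetric] xk_def[symmetric] eg_def[symmetric] ef_def[symmetric]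
        by (simp only:) algebra
    qed
    finally have d: "FL.eval d ?x = c \<otimes>\<^bsub>FL\<^esub> FL.eval g ?x \<oplus>\<^bsub>FL\<^esub> (\<ominus>\<^bsub>FL\<^esub> ((a \<otimes>\<^bsub>FL\<^esub> ?x [^]\<^bsub>FL\<^esub> k) \<otimes>\<^bsub>FL\<^esub> FL.eval (c # f) ?x))"
      by (simp add: FL.minus_eq)
    have gx: "FL.eval g ?x = (\<zero>\<^bsub>F\<^esub>, L.eval (map snd g) t)"
      using eval_pair[of g b t] less.prems GC b t by auto
    have fx: "FL.eval (c # f) ?x = \<zero>\<^bsub>FL\<^esub>"
      using eval_pair[of "c # f" b t] root_b root_t cf GC b t by (auto simp: RDirProd_sel)
    have "FL.eval d ?x = c \<otimes>\<^bsub>FL\<^esub> FL.eval g ?x"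
    proof -
      have "FL.eval g ?x \<in> carrier FL" using less.prems(1) GC x by (intro FL.eval_in_carrier) auto
      then show ?thesis unfolding d fx using car x by (simp add: FL.r_null FL.nat_pow_closed)
    qed
    moreover have "FL.eval d ?x = (F.eval (map fst d) b, L.eval (map snd d) t)"
      using eval_pair[of d b t] dG GC b t by auto
    ultimately have fd: "F.eval (map fst d) b = \<zero>\<^bsub>F\<^esub>"
      and sd: "L.eval (map snd d) t = snd c \<otimes>\<^bsub>L\<^esub> L.eval (map snd g) t"
      using car(3) unfolding gx by (auto simp: RDirProd_sel)
    have "snd c \<otimes>\<^bsub>L\<^esub> L.eval (map snd g) t = \<zero>\<^bsub>L\<^esub>"
      using less.hyps[OF short dG fd] sd by simp
    moreover have "L.eval (map snd g) t \<in> carrier L"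
      using less.prems(1) GC t by (intro L.eval_in_carrier) (auto simp: RDirProd_sel)
    ultimately show ?thesis using lead car(3) L.integral[of "snd c"] by (auto simp: RDirProd_sel)
  qed
qed

end

section \<open>Separating the elements of a finitely generated ring\<close>

text \<open>Asking for a homomorphism that does not kill a prescribed nonzero element, rather than for any
  homomorphism, is what makes the property inductive: to extend a homomorphism to \<open>A[b]\<close> certain
  elements of \<open>A\<close>, such as leading coefficients, must have nonzero image.\<close>
definition separated_by ::
    "('b, 'd) ring_scheme set \<Rightarrow> ('a, 'c) ring_scheme \<Rightarrow> 'a set \<Rightarrow> bool"
  where "separated_by C F A \<longleftrightarrow> (\<forall>a\<in>A - {\<zero>\<^bsub>F\<^esub>}. \<exists>L\<in>C. \<exists>G. partial_hom F L G \<and> fst ` G = A \<and> (a, \<zero>\<^bsub>L\<^esub>) \<notin> G)"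

text \<open>A transcendental \<open>b\<close> satisfies no relation, so \<open>t\<close> is free. For \<open>g\<close> not to vanish at \<open>t\<close>, take \<open>t\<close> to be
  a root of \<open>X g + 1\<close>, which is not constant because the leading coefficient of \<open>g\<close> survives.\<close>
lemma (in field_pair) transcendental_extend:
  assumes alg: "algebraically_closed L"
    and G: "partial_hom F L G" and A: "fst ` G = A"
    and b: "b \<in> carrier F" and trans: "F.transcendental A b"
    and g: "g \<in> carrier (A[X]\<^bsub>F\<^esub>)" "g \<noteq> []" and lead: "(hd g, \<zero>\<^bsub>L\<^esub>) \<notin> G"
  obtains t where "t \<in> carrier L" "partial_hom F L (FL.simple_extension G (b, t))"
    "(F.eval g b, \<zero>\<^bsub>L\<^esub>) \<notin> FL.simple_extension G (b, t)"
proof -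
  interpret L: algebraically_closed L by (rule alg)
  note GC = partial_hom_carrier[OF G]
  have "set g \<subseteq> A" using g(1) F.polynomial_incl by (simp add: univ_poly_carrier[symmetric])
  then obtain g' where g': "set g' \<subseteq> G" "map fst g' = g" using list_lift A by metis
  then obtain u h where uh: "g' = u # h" using g(2) by (cases g') auto
  have u: "u \<in> G" "fst u = hd g" using g' uh by auto
  then have su: "snd u \<noteq> \<zero>\<^bsub>L\<^esub>" using lead by (metis prod.collapse)
  have sndc: "set (map snd g') \<subseteq> carrier L" using g'(1) GC by (auto simp: RDirProd_sel)
  let ?p = "map snd g' @ [\<one>\<^bsub>L\<^esub>]"
  have p: "?p \<in> carrier (poly_ring L)"
    using sndc su by (auto simp: univ_poly_carrier[symmetric] polynomial_def uh)
  obtain t where t: "t \<in> carrier L" "L.eval ?p t = \<zero>\<^bsub>L\<^esub>"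
    by (rule L.has_root[OF p]) (auto simp: uh)
  have "L.eval (map snd g') t \<otimes>\<^bsub>L\<^esub> t \<oplus>\<^bsub>L\<^esub> \<one>\<^bsub>L\<^esub> = \<zero>\<^bsub>L\<^esub>"
    using L.eval_append_aux[OF sndc L.one_closed t(1)] t(2) by simp
  then have nz: "L.eval (map snd g') t \<noteq> \<zero>\<^bsub>L\<^esub>" using t(1) by auto
  have ext: "partial_hom F L (FL.simple_extension G (b, t))"
  proof (rule partial_hom_extend[OF G b t(1)])
    fix h assume h: "set h \<subseteq> G" "F.eval (map fst h) b = \<zero>\<^bsub>F\<^esub>"
    have hA: "set (map fst h) \<subseteq> A" using h(1) A by auto
    have hc: "set (map fst h) \<subseteq> carrier F" using h(1) GC by (auto simp: RDirProd_sel)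
    have "F.normalize (map fst h) \<in> carrier (A[X]\<^bsub>F\<^esub>)"
      using F.normalize_gives_polynomial[OF hA] by (simp add: univ_poly_carrier)
    moreover have "F.eval (F.normalize (map fst h)) b = \<zero>\<^bsub>F\<^esub>"
      using F.eval_normalize[OF hc b] h(2) by simp
    ultimately have "F.normalize (map fst h) = []"
      using F.eval_transcendental[of A b] trans by (simp add: over_def)
    then have "fst u = \<zero>\<^bsub>F\<^esub>" if "u \<in> set h" for u
      using F.normalize_eq_Nil that by fastforce
    then have "snd u = \<zero>\<^bsub>L\<^esub>" if "u \<in> set h" for u
      using that h(1) G unfolding partial_hom_def by (metis prod.collapse subsetD)
    then show "L.eval (map snd h) t = \<zero>\<^bsub>L\<^esub>" using t(1) by (intro L.eval_zeros) auto
  qed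
  have "(F.eval g b, L.eval (map snd g') t) \<in> FL.simple_extension G (b, t)"
    using FL.simple_extension_eval[OF g'(1) GC, of "(b, t)"] eval_pair[of g' b t] b t(1) g' GC
    by (auto simp: RDirProd_sel)
  then have "(F.eval g b, \<zero>\<^bsub>L\<^esub>) \<notin> FL.simple_extension G (b, t)"
    using partial_hom_unique[OF ext] nz by blast
  with t(1) ext that show thesis by blast
qed

text \<open>For algebraic \<open>b\<close> the value \<open>t\<close> is forced to be a root of the image of the minimal relation \<open>f\<close>, and
  such a root is good enough. The image has the same degree as \<open>f\<close> because the leading coefficient
  survives, so it has a root.\<close>
lemma (in field_pair) algebraic_extend:
  assumes alg: "algebraically_closed L"
    and G: "partial_hom F L G" and A: "fst ` G = A"
    and b: "b \<in> carrier F"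
    and f: "set f \<subseteq> A" "f \<noteq> []" "F.eval f b = \<zero>\<^bsub>F\<^esub>" and lead: "(hd f, \<zero>\<^bsub>L\<^esub>) \<notin> G"
    and minimal: "\<And>g. set g \<subseteq> A \<Longrightarrow> length g < length f \<Longrightarrow> F.eval g b = \<zero>\<^bsub>F\<^esub> \<Longrightarrow> \<forall>u\<in>set g. u = \<zero>\<^bsub>F\<^esub>"
  obtains t where "t \<in> carrier L" "partial_hom F L (FL.simple_extension G (b, t))"
proof -
  interpret L: algebraically_closed L by (rule alg)
  note GC = partial_hom_carrier[OF G]
  have sG: "subring G FL" using G by (simp add: partial_hom_def)
  obtain f' where f': "set f' \<subseteq> G" "map fst f' = f" using list_lift f(1) A by metis
  then obtain c h where ch: "f' = c # h" using f(2) by (cases f') auto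
  have c: "c \<in> G" "fst c = hd f" "set h \<subseteq> G" using f' ch by auto
  then have sc: "snd c \<noteq> \<zero>\<^bsub>L\<^esub>" using lead by (metis prod.collapse)
  have fc: "fst c \<noteq> \<zero>\<^bsub>F\<^esub>"
    using c(1) sc G unfolding partial_hom_def by (metis prod.collapse)
  have cc: "c \<in> carrier FL" using c(1) GC by blast
  \<comment> \<open>A relation of degree \<open>0\<close> would say that the leading coefficient is \<open>0\<close>.\<close>
  have "h \<noteq> []"
  proof
    assume "h = []"
    then have "F.eval f b = fst c" using f'(2) ch cc by (auto simp: RDirProd_sel)
    then show False using f(3) fc by simp
  qed
  let ?p = "map snd f'"
  have "set ?p \<subseteq> carrier L" using f'(1) GC by (auto simp: RDirProd_sel)
  then have p: "?p \<in> carrier (poly_ring L)"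
    using sc by (auto simp: univ_poly_carrier[symmetric] polynomial_def ch)
  obtain t where t: "t \<in> carrier L" "L.eval ?p t = \<zero>\<^bsub>L\<^esub>"
    by (rule L.has_root[OF p]) (use \<open>h \<noteq> []\<close> in \<open>auto simp: ch\<close>)
  have "partial_hom F L (FL.simple_extension G (b, t))"
  proof (rule partial_hom_extend[OF G b t(1)])
    fix g assume g: "set g \<subseteq> G" "F.eval (map fst g) b = \<zero>\<^bsub>F\<^esub>"
    show "L.eval (map snd g) t = \<zero>\<^bsub>L\<^esub>"
    proof (rule relations_transfer_from_minimal[OF G b t(1) _ _ _ sc _ g])
      show "set (c # h) \<subseteq> G" "F.eval (map fst (c # h)) b = \<zero>\<^bsub>F\<^esub>" "L.eval (map snd (c # h)) t = \<zero>\<^bsub>L\<^esub>"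
        using f' f(3) t(2) unfolding ch by simp_all
      fix k assume k: "set k \<subseteq> G" "length k \<le> length h" "F.eval (map fst k) b = \<zero>\<^bsub>F\<^esub>"
      have "length (map fst k) < length f" using k(2) f'(2) ch by auto
      moreover have "set (map fst k) \<subseteq> A" using k(1) A by auto
      ultimately show "\<forall>u\<in>set k. fst u = \<zero>\<^bsub>F\<^esub>" using minimal[OF _ _ k(3)] by auto
    qed
  qed
  with t(1) that show thesis by blast
qed

text \<open>To keep \<open>y \<in> A[b]\<close> alive, it suffices to keep alive one suitable element of \<open>A\<close>. If \<open>b\<close> is
  transcendental and \<open>y = g(b)\<close>, that is the leading coefficient of \<open>g\<close>. If \<open>b\<close> is algebraic, it is the
  product of the leading coefficient of a minimal relation of \<open>b\<close> (so that the homomorphism extends)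
  and a nonzero multiple \<open>e \<in> A\<close> of \<open>y\<close> (a homomorphism killing \<open>y\<close> would kill \<open>e\<close>).\<close>
lemma separated_by_simple_extension:
  assumes F: "field F" and C: "\<And>L. L \<in> C \<Longrightarrow> algebraically_closed L"
    and A: "subring A F" and b: "b \<in> carrier F" and sep: "separated_by C F A"
  shows "separated_by C F (ring.simple_extension F A b)"
proof -
  interpret F: field F by (rule F)
  have Ac: "A \<subseteq> carrier F" by (rule subringE(1)[OF A])
  show ?thesis
    unfolding separated_by_def
  proof
    fix y assume y: "y \<in> F.simple_extension A b - {\<zero>\<^bsub>F\<^esub>}"
    show "\<exists>L\<in>C. \<exists>G. partial_hom F L G \<and> fst ` G = F.simple_extension A b \<and> (y, \<zero>\<^bsub>L\<^esub>) \<notin> G"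
    proof (cases "F.transcendental A b")
      case True
      obtain g where g: "g \<in> carrier (A[X]\<^bsub>F\<^esub>)" "y = F.eval g b"
        using F.simple_extension_evalE[OF _ Ac b] y by blast
      then have "g \<noteq> []" using y by auto
      then have "hd g \<in> A - {\<zero>\<^bsub>F\<^esub>}"
        using g(1) by (auto simp: univ_poly_carrier[symmetric] polynomial_def)
      then obtain L G where L: "L \<in> C" and G: "partial_hom F L G" "fst ` G = A" "(hd g, \<zero>\<^bsub>L\<^esub>) \<notin> G"
        using sep unfolding separated_by_def by blast
      interpret L: algebraically_closed L by (rule C[OF L])
      interpret field_pair F L ..
      obtain t where "partial_hom F L (FL.simple_extension G (b, t))"
        "(y, \<zero>\<^bsub>L\<^esub>) \<notin> FL.simple_extension G (b, t)"
        using transcendental_extend[OF C[OF L] G(1,2) b True g(1) \<open>g \<noteq> []\<close> G(3)] g(2) by metis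
      moreover have "fst ` FL.simple_extension G (b, t) = F.simple_extension A b"
        using fst_simple_extension G(2) by simp
      ultimately show ?thesis using L by blast
    next
      case False
      let ?P = "\<lambda>f. set f \<subseteq> A \<and> f \<noteq> [] \<and> hd f \<noteq> \<zero>\<^bsub>F\<^esub> \<and> F.eval f b = \<zero>\<^bsub>F\<^esub>"
      obtain p where p: "p \<in> carrier (A[X]\<^bsub>F\<^esub>)" "p \<noteq> []" "F.eval p b = \<zero>\<^bsub>F\<^esub>"
        using F.algebraicE[OF A b] False by (auto simp: over_def)
      then have "?P p" by (auto simp: univ_poly_carrier[symmetric] polynomial_def)
      then obtain f where f: "?P f" and least: "\<And>g. ?P g \<Longrightarrow> length f \<le> length g"
        using ex_has_least_nat[of ?P p length] by blast
      have minimal: "\<forall>u\<in>set g. u = \<zero>\<^bsub>F\<^esub>"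
        if g: "set g \<subseteq> A" "length g < length f" "F.eval g b = \<zero>\<^bsub>F\<^esub>" for g
      proof (rule ccontr)
        let ?n = "F.normalize g"
        assume "\<not> ?thesis"
        then have "?n \<noteq> []" using F.normalize_eq_Nil by blast
        moreover have "polynomial\<^bsub>F\<^esub> A ?n" by (rule F.normalize_gives_polynomial[OF g(1)])
        moreover have "F.eval ?n b = \<zero>\<^bsub>F\<^esub>" using F.eval_normalize[of g b] g Ac b by auto
        ultimately have "length f \<le> length ?n" by (intro least) (auto simp: polynomial_def)
        then show False using F.normalize_length_le[of g] g(2) by simp
      qed
      obtain z where z: "z \<in> F.simple_extension A b" "y \<otimes>\<^bsub>F\<^esub> z \<in> A - {\<zero>\<^bsub>F\<^esub>}"
        using F.algebraic_divides_nonzero_constant[OF A b _ , of y] False y by (auto simp: over_def)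
      define e where "e = y \<otimes>\<^bsub>F\<^esub> z"
      have a: "hd f \<in> A" using f by (cases f) auto
      have e: "e \<in> A" "e \<noteq> \<zero>\<^bsub>F\<^esub>" using z by (auto simp: e_def)
      have "hd f \<otimes>\<^bsub>F\<^esub> e \<in> A - {\<zero>\<^bsub>F\<^esub>}"
        using f a e Ac subringE(6)[OF A] F.integral[of "hd f" e] by blast
      then obtain L G where L: "L \<in> C" and G: "partial_hom F L G" "fst ` G = A"
          "(hd f \<otimes>\<^bsub>F\<^esub> e, \<zero>\<^bsub>L\<^esub>) \<notin> G"
        using sep unfolding separated_by_def by blast
      interpret L: algebraically_closed L by (rule C[OF L])
      interpret field_pair F L ..
      have sG: "subring G FL" using G by (simp add: partial_hom_def)
      note GC = partial_hom_carrier[OF G(1)]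
      obtain w v where w: "(e, w) \<in> G" and v: "(hd f, v) \<in> G" using e(1) a G(2) by force
      have wv: "w \<in> carrier L" "v \<in> carrier L" using w v GC by (auto simp: RDirProd_sel)
      have "(hd f \<otimes>\<^bsub>F\<^esub> e, v \<otimes>\<^bsub>L\<^esub> w) \<in> G"
        using subringE(6)[OF sG v w] by (simp add: RDirProd_sel)
      then have "w \<noteq> \<zero>\<^bsub>L\<^esub>" "v \<noteq> \<zero>\<^bsub>L\<^esub>" using G(3) wv by auto
      then have lead: "(hd f, \<zero>\<^bsub>L\<^esub>) \<notin> G" using partial_hom_unique[OF G(1) v] by blast
      obtain t where t: "t \<in> carrier L" and ext: "partial_hom F L (FL.simple_extension G (b, t))"
        using algebraic_extend[OF C[OF L] G(1,2) b _ _ _ lead minimal] f by metis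
      have bt: "(b, t) \<in> carrier FL" using b t by (simp add: RDirProd_sel)
      have fstG': "fst ` FL.simple_extension G (b, t) = F.simple_extension A b"
        using fst_simple_extension G(2) by simp
      have "(y, \<zero>\<^bsub>L\<^esub>) \<notin> FL.simple_extension G (b, t)"
      proof
        assume y0: "(y, \<zero>\<^bsub>L\<^esub>) \<in> FL.simple_extension G (b, t)"
        obtain v where v: "(z, v) \<in> FL.simple_extension G (b, t)" using z(1) fstG' by force
        have "v \<in> carrier L" using v partial_hom_carrier[OF ext] by (auto simp: RDirProd_sel)
        then have "(e, \<zero>\<^bsub>L\<^esub>) \<in> FL.simple_extension G (b, t)"
          using subringE(6)[OF FL.simple_extension_subring[OF sG bt] y0 v]
          by (simp add: RDirProd_sel e_def)
        moreover have "(e, w) \<in> FL.simple_extension G (b, t)"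
          using w FL.simple_extension_incl[OF GC bt] by blast
        ultimately show False using partial_hom_unique[OF ext] \<open>w \<noteq> \<zero>\<^bsub>L\<^esub>\<close> by blast
      qed
      then show ?thesis using L ext fstG' by blast
    qed
  qed
qed

lemma separated_by_finite_extension:
  assumes F: "field F" and C: "\<And>L. L \<in> C \<Longrightarrow> algebraically_closed L"
    and A: "subring A F" and xs: "set xs \<subseteq> carrier F" and sep: "separated_by C F A"
  shows "separated_by C F (ring.finite_extension F A xs)"
proof -
  interpret F: field F by (rule F)
  show ?thesis
    using xs
  proof (induction xs)
    case (Cons x xs)
    then have "separated_by C F (F.simple_extension (F.finite_extension A xs) x)"
      by (intro separated_by_simple_extension[OF F C F.finite_extension_is_subring[OF A]]) auto
    then show ?case by simp
  qed (simp add: sep)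
qed

section \<open>The base case: integer multiples of one\<close>

lemma (in ring) int_mult_one:
  "add_pow R (i :: int) \<one> \<otimes> add_pow R j \<one> = add_pow R (i * j) \<one>"
  by (simp add: add_pow_ldistr_int add.int_pow_pow mult.commute)

lemma (in ring) int_mult_one_eq_zero: "add_pow R (i :: int) \<one> = \<zero> \<longleftrightarrow> int (ring_char R) dvd i"
  using add.int_pow_eq_id[of \<one> i] by (simp add: ring_char_def)

lemma (in domain) prime_ring_char:
  assumes "ring_char R \<noteq> 0" shows "Factorial_Ring.prime (ring_char R)"
proof -
  have "\<not> int (ring_char R) dvd 1"
    using int_mult_one_eq_zero[of 1] by simp
  moreover have "int (ring_char R) dvd i \<or> int (ring_char R) dvd j"
    if "int (ring_char R) dvd i * j" for i j
  proof -
    have "add_pow R i \<one> \<otimes> add_pow R j \<one> = \<zero>"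
      using that int_mult_one_eq_zero by (simp add: int_mult_one)
    then show ?thesis using integral int_mult_one_eq_zero by blast
  qed
  ultimately have "prime_elem (int (ring_char R))"
    using assms unfolding prime_elem_def by auto
  then show ?thesis by (simp add: prime_elem_iff_prime_abs)
qed

lemma (in ring_hom_ring) hom_int_mult_one: "h (add_pow R (i :: int) \<one>) = add_pow S i \<one>\<^bsub>S\<^esub>"
  using group_hom.hom_int_pow[OF abelian_group.a_group_hom, of \<one> i]
  by (simp add: add_pow_def)

lemma (in ring) subring_int_multiples: "subring (range (\<lambda>i::int. add_pow R i \<one>)) R"
proof (rule subringI)
  let ?m = "\<lambda>i::int. add_pow R i \<one>"
  show "range ?m \<subseteq> carrier R" by auto
  have "\<one> = ?m 1" by simp
  then show "\<one> \<in> range ?m" by blast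
  fix u assume "u \<in> range ?m"
  then obtain i where u: "u = ?m i" by blast
  have "\<ominus> u = ?m (- i)" by (simp add: u add.int_pow_neg)
  then show "\<ominus> u \<in> range ?m" by blast
  fix v assume "v \<in> range ?m"
  then obtain j where v: "v = ?m j" by blast
  show "u \<otimes> v \<in> range ?m" by (simp add: u v int_mult_one)
  have "u \<oplus> v = ?m (i + j)" by (simp add: u v add.int_pow_mult)
  then show "u \<oplus> v \<in> range ?m" by blast
qed

text \<open>The characteristic \<open>p\<close> of the target has to be the one of \<open>F\<close> if that is positive; in
  characteristic \<open>0\<close> any prime not dividing \<open>n\<close> keeps \<open>n \<cdot> 1\<close> alive.\<close>
lemma separated_by_int_multiples:
  assumes F: "field F" and C: "\<And>L. L \<in> C \<Longrightarrow> field L"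
    and chars: "\<And>p. Factorial_Ring.prime p \<Longrightarrow> \<exists>L\<in>C. ring_char L = p"
  shows "separated_by C F (range (\<lambda>i::int. add_pow F i \<one>\<^bsub>F\<^esub>))"
  unfolding separated_by_def
proof
  interpret F: field F by (rule F)
  fix a assume "a \<in> range (\<lambda>i::int. add_pow F i \<one>\<^bsub>F\<^esub>) - {\<zero>\<^bsub>F\<^esub>}"
  then obtain n :: int where a: "a = add_pow F n \<one>\<^bsub>F\<^esub>" and n: "\<not> int (ring_char F) dvd n"
    using F.int_mult_one_eq_zero by blast
  obtain p where p: "Factorial_Ring.prime p" "\<not> int p dvd n" "int (ring_char F) dvd m \<Longrightarrow> int p dvd m" for m
  proof (cases "ring_char F = 0")
    case True
    obtain p where p: "Factorial_Ring.prime p" "p > nat \<bar>n\<bar>" using bigger_prime by blast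
    have "\<not> int p dvd n"
    proof
      assume "int p dvd n"
      then have "\<bar>int p\<bar> \<le> \<bar>n\<bar>" using n True by (intro dvd_imp_le_int) auto
      then show False using p(2) by simp
    qed
    with p that True show thesis by simp
  next
    case False
    then show thesis using that F.prime_ring_char n by blast
  qed
  obtain L where L: "L \<in> C" "ring_char L = p" using chars p(1) by blast
  interpret L: field L by (rule C[OF L(1)])
  interpret field_pair F L ..
  let ?m = "\<lambda>i::int. add_pow FL i \<one>\<^bsub>FL\<^esub>"
  have m: "?m i = (add_pow F i \<one>\<^bsub>F\<^esub>, add_pow L i \<one>\<^bsub>L\<^esub>)" for i
    using fst.ring.hom_int_mult_one[of i] snd.ring.hom_int_mult_one[of i] by (simp add: prod_eq_iff)
  have "add_pow L i \<one>\<^bsub>L\<^esub> = \<zero>\<^bsub>L\<^esub>" if "add_pow F i \<one>\<^bsub>F\<^esub> = \<zero>\<^bsub>F\<^esub>" for i :: int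
    using that p(3) by (simp add: F.int_mult_one_eq_zero L.int_mult_one_eq_zero L(2))
  then have G: "partial_hom F L (range ?m)"
    using FL.subring_int_multiples unfolding partial_hom_def m by force
  have "(a, \<zero>\<^bsub>L\<^esub>) \<notin> range ?m"
  proof
    assume "(a, \<zero>\<^bsub>L\<^esub>) \<in> range ?m"
    moreover have "(a, add_pow L n \<one>\<^bsub>L\<^esub>) \<in> range ?m" by (auto simp: a m)
    ultimately have "add_pow L n \<one>\<^bsub>L\<^esub> = \<zero>\<^bsub>L\<^esub>" using partial_hom_unique[OF G] by blast
    then show False using p(2) by (simp add: L.int_mult_one_eq_zero L(2))
  qed
  moreover have "fst ` range ?m = range (\<lambda>i::int. add_pow F i \<one>\<^bsub>F\<^esub>)" by (auto simp: image_image m)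
  ultimately show "\<exists>L\<in>C. \<exists>G. partial_hom F L G \<and> fst ` G = range (\<lambda>i::int. add_pow F i \<one>\<^bsub>F\<^esub>) \<and> (a, \<zero>\<^bsub>L\<^esub>) \<notin> G"
    using L(1) G by blast
qed

section \<open>Algebraic closures of finite fields\<close>

text \<open>As target fields, algebraic closures of finite fields have two advantages over the finite
  fields themselves: roots exist without changing the field, and for all characteristics
  they can be realised on one type.\<close>
definition closed_over_finite :: "('a, 'b) ring_scheme \<Rightarrow> bool"
  where "closed_over_finite L \<longleftrightarrow> algebraically_closed L \<and>
    (\<exists>K. subfield K L \<and> finite K \<and> (\<forall>x\<in>carrier L. ((ring.algebraic L) over K) x))"

lemma closed_over_finite_exists:
  assumes "Factorial_Ring.prime p"
  obtains L :: "((int list \<times> nat) multiset \<Rightarrow> int) ring"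
  where "closed_over_finite L" "ring_char L = p"
proof -
  interpret R: residues_prime p "residue_ring (int p)" by unfold_locales (auto simp: assms)
  let ?R = "residue_ring (int p)"
  define L where "L = R.alg_closure"
  note E = R.alg_closureE[folded L_def]
  interpret L: algebraic_closure L "R.indexed_const ` carrier ?R" by (rule E)
  have "closed_over_finite L"
    unfolding closed_over_finite_def
    using L.algebraically_closed_axioms L.algebraic_extension E(1)
    by (auto simp: algebraic_closure_def intro!: exI[of _ "R.indexed_const ` carrier ?R"])
  interpret h: ring_hom_ring ?R L R.indexed_const by unfold_locales (rule E(2))
  have "order (add_monoid ?R) = p" by (simp add: order_def R.res_carrier_eq)
  then have "add_pow ?R p \<one>\<^bsub>?R\<^esub> = \<zero>\<^bsub>?R\<^esub>"
    using R.add.pow_order_eq_1[OF R.one_closed] by simp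
  moreover have "R.indexed_const (add_pow ?R p \<one>\<^bsub>?R\<^esub>) = add_pow L p (R.indexed_const \<one>\<^bsub>?R\<^esub>)"
    using group_hom.hom_nat_pow[OF h.abelian_group.a_group_hom, of "\<one>\<^bsub>?R\<^esub>" p]
    by (simp add: add_pow_def)
  ultimately have "add_pow L p \<one>\<^bsub>L\<^esub> = \<zero>\<^bsub>L\<^esub>" by simp
  then have "ring_char L dvd p" by (simp add: L.ring_char_dvd)
  moreover have "ring_char L \<noteq> 1" using L.ring_char_dvd[of 1] by auto
  ultimately have "ring_char L = p" using assms by (metis prime_nat_iff)
  with \<open>closed_over_finite L\<close> that show thesis by blast
qed

lemma (in domain) finite_finite_extension:
  assumes K: "subfield K R" and fin: "finite K" and xs: "set xs \<subseteq> carrier R"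
    and alg: "\<And>x. x \<in> set xs \<Longrightarrow> (algebraic over K) x"
  shows "finite (finite_extension K xs)"
proof -
  obtain n where "dimension n K (finite_extension K xs)"
    using finite_extension_finite_dimension(1)[OF K xs alg] by blast
  then obtain Us where Us: "set Us \<subseteq> carrier R" "Span K Us = finite_extension K xs"
    using exists_base[OF K] by blast
  have "Span K Us = (\<lambda>Ks. combine Ks Us) ` {Ks. set Ks \<subseteq> K \<and> length Ks = length Us}"
    using Span_eq_combine_set_length_version[OF K Us(1)] by blast
  then have "finite (Span K Us)" using finite_lists_length_eq[OF fin] by (simp only: finite_imageI)
  then show ?thesis by (simp only: Us(2))
qed

section \<open>Descent to a finite field\<close>

lemma (in domain) two_eq_zero_iff: "\<one> \<oplus> \<one> = \<zero> \<longleftrightarrow> ring_char R = 2"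
proof -
  have "\<one> \<oplus> \<one> = add_pow R (2::nat) \<one>" by (simp add: numeral_2_eq_2)
  then have "\<one> \<oplus> \<one> = \<zero> \<longleftrightarrow> ring_char R dvd 2" by (simp add: ring_char_dvd)
  moreover have "ring_char R \<noteq> 1" using ring_char_dvd[of 1] by auto
  ultimately show ?thesis using two_is_prime_nat by (metis dvd_refl prime_nat_iff)
qed

lemma finite_field_nat_copy:
  fixes K :: "('a, 'b) ring_scheme"
  assumes "field K" "finite (carrier K)" "ring_char K \<noteq> 2" "sums_of_squares_formula K r s n \<alpha>"
  shows "\<exists>N :: nat ring. field N \<and> finite (carrier N) \<and> ring_char N \<noteq> 2 \<and>
           (\<exists>\<beta>. sums_of_squares_formula N r s n \<beta>)"
proof -
  interpret K: field K by (rule assms(1))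
  define h where "h = to_nat_on (carrier K)"
  have inj: "inj_on h (carrier K)"
    unfolding h_def by (rule inj_on_to_nat_on) (rule countable_finite[OF assms(2)])
  let ?N = "image_ring h K"
  interpret N: field ?N by (rule K.inj_imp_image_ring_is_field[OF inj])
  interpret h: ring_hom_cring K ?N h
    by unfold_locales (use inj_imp_image_ring_iso[OF inj] in \<open>simp add: ring_iso_def\<close>)
  have "\<one>\<^bsub>K\<^esub> \<oplus>\<^bsub>K\<^esub> \<one>\<^bsub>K\<^esub> = \<zero>\<^bsub>K\<^esub>" if "\<one>\<^bsub>?N\<^esub> \<oplus>\<^bsub>?N\<^esub> \<one>\<^bsub>?N\<^esub> = \<zero>\<^bsub>?N\<^esub>"
  proof -
    have "h (\<one>\<^bsub>K\<^esub> \<oplus>\<^bsub>K\<^esub> \<one>\<^bsub>K\<^esub>) = h \<zero>\<^bsub>K\<^esub>" using that by simp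
    then show ?thesis using inj by (meson K.add.m_closed K.one_closed K.zero_closed inj_onD)
  qed
  then have "ring_char ?N \<noteq> 2" using assms(3) by (simp flip: K.two_eq_zero_iff N.two_eq_zero_iff) blast
  moreover have "sums_of_squares_formula ?N r s n (\<lambda>i j k. h (\<alpha> i j k))"
    by (rule h.sums_of_squares_formula_hom(1)[OF _ _ assms(4)])
       (use assms(4) in \<open>auto simp: sums_of_squares_formula_def\<close>)
  moreover have "finite (carrier ?N)" using assms(2) by (simp add: image_ring_carrier)
  ultimately show ?thesis using N.field_axioms by blast
qed

text \<open>Only finitely many coefficients are involved, and each of them is algebraic over the finite
  subfield, so together they generate a finite field.\<close>
lemma closed_over_finite_descent:
  assumes L: "closed_over_finite L" and char: "ring_char L \<noteq> 2"
    and \<beta>: "sums_of_squares_formula L r s n \<beta>"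
  shows "\<exists>K :: nat ring. field K \<and> finite (carrier K) \<and> ring_char K \<noteq> 2 \<and>
           (\<exists>\<alpha>. sums_of_squares_formula K r s n \<alpha>)"
proof -
  interpret L: algebraically_closed L using L by (simp add: closed_over_finite_def)
  obtain K0 where K0: "subfield K0 L" "finite K0" "\<And>x. x \<in> carrier L \<Longrightarrow> (L.algebraic over K0) x"
    using L by (auto simp: closed_over_finite_def)
  obtain ts where ts: "set ts = {1..n} \<times> {1..r} \<times> {1..s}"
    using finite_list[of "{1..n} \<times> {1..r} \<times> {1..s}"] by blast
  define ws where "ws = map (\<lambda>(i, j, k). \<beta> i j k) ts"
  have ws: "set ws \<subseteq> carrier L"
    using \<beta> by (auto simp: ws_def ts sums_of_squares_formula_def)
  define K where "K = L.finite_extension K0 ws"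
  have K: "subfield K L"
    unfolding K_def by (rule L.finite_extension_is_subfield[OF K0(1) ws]) (use ws K0(3) in blast)
  have finK: "finite K"
    unfolding K_def by (rule L.finite_finite_extension[OF K0(1,2) ws]) (use ws K0(3) in blast)
  have \<beta>_K: "\<beta> i j k \<in> K" if "i \<in> {1..n}" "j \<in> {1..r}" "k \<in> {1..s}" for i j k
    using L.finite_extension_mem[OF subfieldE(1)[OF K0(1)] ws] that by (force simp: ws_def ts K_def)
  let ?K = "L\<lparr>carrier := K\<rparr>"
  interpret K: field ?K by (rule L.subfield_iff(2)[OF K])
  interpret incl: ring_hom_cring ?K L "\<lambda>x. x"
    by unfold_locales (use subfieldE(3)[OF K] in \<open>auto simp: ring_hom_def\<close>)
  have "sums_of_squares_formula ?K r s n \<beta>"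
    by (rule incl.sums_of_squares_formula_hom(2)[OF _ _ _ \<beta>]) (use \<beta>_K in auto)
  moreover have "ring_char ?K \<noteq> 2"
    using char L.two_eq_zero_iff K.two_eq_zero_iff by simp
  ultimately show ?thesis
    using finite_field_nat_copy[OF K.field_axioms] finK by simp
qed

text \<open>The graph \<open>G\<close> is itself a commutative ring. Its projection to \<open>F\<close> is injective, so the formula
  holds over \<open>G\<close>; its projection to \<open>L\<close> is a homomorphism, so the formula holds over \<open>L\<close>.\<close>
lemma (in field_pair) sums_of_squares_formula_partial_hom:
  assumes G: "partial_hom F L G" and \<alpha>: "sums_of_squares_formula F r s n \<alpha>"
    and dom: "\<And>i j k. i \<in> {1..n} \<Longrightarrow> j \<in> {1..r} \<Longrightarrow> k \<in> {1..s} \<Longrightarrow> \<alpha> i j k \<in> fst ` G"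
  shows "\<exists>\<beta>. sums_of_squares_formula L r s n \<beta>"
proof -
  have sG: "subring G FL" using G by (simp add: partial_hom_def)
  note GC = partial_hom_carrier[OF G]
  define \<gamma> where "\<gamma> = (\<lambda>i j k. SOME u. u \<in> G \<and> fst u = \<alpha> i j k)"
  have \<gamma>: "\<gamma> i j k \<in> G" "fst (\<gamma> i j k) = \<alpha> i j k" if "i \<in> {1..n}" "j \<in> {1..r}" "k \<in> {1..s}" for i j k
  proof -
    have "\<exists>u. u \<in> G \<and> fst u = \<alpha> i j k" using dom[OF that] by (elim imageE) metis
    from someI_ex[OF this] show "\<gamma> i j k \<in> G" "fst (\<gamma> i j k) = \<alpha> i j k"
      unfolding \<gamma>_def by blast+
  qed
  let ?G = "FL\<lparr>carrier := G\<rparr>"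
  interpret G: cring ?G using FL.subcring_iff[OF GC] FL.subcringI'[OF sG] by simp
  interpret fstG: ring_hom_cring ?G F fst
    by unfold_locales (use GC in \<open>auto simp: ring_hom_def RDirProd_sel\<close>)
  interpret sndG: ring_hom_cring ?G L snd
    by unfold_locales (use GC in \<open>auto simp: ring_hom_def RDirProd_sel\<close>)
  have inj: "inj_on fst (carrier ?G)"
    using partial_hom_unique[OF G] by (auto simp: inj_on_def)
  have "sums_of_squares_formula ?G r s n \<gamma>"
    by (rule fstG.sums_of_squares_formula_hom(2)[OF _ _ inj \<alpha>]) (use \<gamma> in auto)
  then have "sums_of_squares_formula L r s n (\<lambda>i j k. snd (\<gamma> i j k))"
    by (rule sndG.sums_of_squares_formula_hom(1)[rotated 2]) (use \<gamma> in auto)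
  then show ?thesis by blast
qed

theorem corollary1p3:
  fixes F :: "('a, 'b) ring_scheme" and r s n :: nat
  assumes "r > 0" and "s > 0" and "n > 0"
    and "field F" and "ring_char F \<noteq> 2"
    and "\<exists>\<alpha>. sums_of_squares_formula F r s n \<alpha>"
  shows "\<exists>K :: nat ring. field K \<and> finite (carrier K) \<and> ring_char K \<noteq> 2 \<and>
           (\<exists>\<alpha>. sums_of_squares_formula K r s n \<alpha>)"
proof -
  interpret F: field F by (rule assms(4))
  obtain \<alpha> where \<alpha>: "sums_of_squares_formula F r s n \<alpha>" using assms(6) by blast
  obtain ts where ts: "set ts = {1..n} \<times> {1..r} \<times> {1..s}"
    using finite_list[of "{1..n} \<times> {1..r} \<times> {1..s}"] by blast
  define A0 where "A0 = range (\<lambda>i::int. add_pow F i \<one>\<^bsub>F\<^esub>)"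
  define xs where "xs = map (\<lambda>(i, j, k). \<alpha> i j k) ts"
  define A where "A = F.finite_extension A0 xs"
  let ?C = "Collect closed_over_finite :: ((int list \<times> nat) multiset \<Rightarrow> int) ring set"
  have C: "algebraically_closed L" if "L \<in> ?C" for L using that by (simp add: closed_over_finite_def)
  have A0: "subring A0 F" unfolding A0_def by (rule F.subring_int_multiples)
  have xs: "set xs \<subseteq> carrier F" using \<alpha> by (auto simp: xs_def ts sums_of_squares_formula_def)
  have A: "subring A F" unfolding A_def by (rule F.finite_extension_is_subring[OF A0 xs])
  have \<alpha>_A: "\<alpha> i j k \<in> A" if "i \<in> {1..n}" "j \<in> {1..r}" "k \<in> {1..s}" for i j k
    using F.finite_extension_mem[OF A0 xs] that by (force simp: xs_def ts A_def)
  have "separated_by ?C F A0"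
    unfolding A0_def
  proof (rule separated_by_int_multiples[OF assms(4)])
    show "field L" if "L \<in> ?C" for L using C[OF that] by (simp add: algebraically_closed_def)
    show "\<exists>L\<in>?C. ring_char L = p" if "Factorial_Ring.prime p" for p
      using closed_over_finite_exists[OF that] by blast
  qed
  then have "separated_by ?C F A"
    unfolding A_def by (intro separated_by_finite_extension[OF assms(4) _ A0 xs] C)
  \<comment> \<open>The element to keep alive is \<open>2\<close>: this excludes characteristic \<open>2\<close> for the target.\<close>
  moreover have "\<one>\<^bsub>F\<^esub> \<oplus>\<^bsub>F\<^esub> \<one>\<^bsub>F\<^esub> \<in> A - {\<zero>\<^bsub>F\<^esub>}"
    using assms(5) F.two_eq_zero_iff subringE(3,7)[OF A] by simp
  ultimately obtain L G where L: "L \<in> ?C" and G: "partial_hom F L G" "fst ` G = A"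
      "(\<one>\<^bsub>F\<^esub> \<oplus>\<^bsub>F\<^esub> \<one>\<^bsub>F\<^esub>, \<zero>\<^bsub>L\<^esub>) \<notin> G"
    unfolding separated_by_def by blast
  interpret L: algebraically_closed L by (rule C[OF L])
  interpret field_pair F L ..
  have sG: "subring G FL" using G(1) by (simp add: partial_hom_def)
  have "\<one>\<^bsub>FL\<^esub> \<oplus>\<^bsub>FL\<^esub> \<one>\<^bsub>FL\<^esub> \<in> G" using subringE(3,7)[OF sG] by blast
  then have "\<one>\<^bsub>L\<^esub> \<oplus>\<^bsub>L\<^esub> \<one>\<^bsub>L\<^esub> \<noteq> \<zero>\<^bsub>L\<^esub>" using G(3) by (auto simp: RDirProd_sel)
  then have "ring_char L \<noteq> 2" using L.two_eq_zero_iff by simp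
  moreover obtain \<beta> where "sums_of_squares_formula L r s n \<beta>"
    using sums_of_squares_formula_partial_hom[OF G(1) \<alpha>] \<alpha>_A G(2) by blast
  ultimately show ?thesis using closed_over_finite_descent L by blast
qed

end
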